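(* Let $Q:\mathbf{T}\to\mathbb{R}$ be a $C^{3}$ potential such that $Q''\ge\rho-\frac12$ on $\mathbf{T}$ for some $\rho\in\mathbb{R}$. Then for every smooth probability measure $\mu$ on $\mathbf{T}$, $$E_Q(\mu)-E_Q(\mu_Q)\le\sqrt{I_Q(\mu)}\;\mathcal{W}_2(\mu,\mu_Q)-\frac{\rho}{2}\,\mathcal{W}_2^{2}(\mu,\mu_Q).$$
   Context: $\mathbf{T}$ is the unit circle in $\mathbb{C}$ and $\alpha$ is the normalized (probability) Haar measure on $\mathbf{T}$. A measure on $\mathbf{T}$ is called smooth if it has a smooth density with respect to $\alpha$. For a differentiable function $\phi$ on $\mathbf{T}$, $\phi'(z)=\frac{d}{dt}\big|_{t=0}\phi(ze^{it})$, and higher derivatives are defined by iterating. For a continuous $Q:\mathbf{T}\to\mathbb{R}$ (a potential) and a probability measure $\mu$ on $\mathbf{T}$, $E_Q(\mu)=\int Q\,d\mu-\iint\log|x-y|\,\mu(dx)\mu(dy)$; $\mu_Q$ denotes the (unique) minimizer of $E_Q$ over probability measures on $\mathbf{T}$. For a smooth probability measure $\mu$ on $\mathbf{T}$, with density $m$ with respect to $\alpha$, define $H\mu:\mathbf{T}\to\mathbb{R}$ by the principal value integral $H\mu(e^{ix})=\mathrm{p.v.}\int\cot\big(\frac{x-y}{2}\big)\,m(e^{iy})\,\frac{dy}{2\pi}$ over an interval of length $2\pi$, and $I_Q(\mu)=\int(H\mu-Q')^{2}\,d\mu-\big(\int Q'\,d\mu\big)^{2}$ (this is non-negative). Modified Wasserstein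 distance: let $\exp(x)=e^{ix}$ for $x\in\mathbb{R}$. For a measure $\mu$ on $\mathbf{T}$ let $\bar\mu$ be the measure on $\mathbb{R}$ given by $\bar\mu(A)=\sum_{n\in\mathbb{Z}}\mu(\exp(A\cap[2n\pi,2(n+1)\pi)))$, and let $\bar\mu_u$ be the restriction of $\bar\mu$ to $[u,u+2\pi)$. For probability measures $\mu,\nu$ on $\mathbf{T}$ and $p\ge1$, $$\mathcal{W}_p(\mu,\nu)=\sup\Big\{W_p(\bar\mu_u,\bar\nu_v): u,v\in[0,2\pi],\ \int x\,\bar\mu_u(dx)=\int x\,\bar\nu_v(dx)\Big\},$$ where $W_p$ is the standard $p$-Wasserstein distance on $\mathbb{R}$ (cost $|x-y|^p$, with the power $1/p$), and the supremum over the empty set is $+\infty$. *)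

theory Defs
  imports "HOL-Probability.Probability"
begin

abbreviation unit_circle :: "complex set" where
  "unit_circle \<equiv> sphere 0 1"

text \<open>A measure on the circle is a measure on this Borel space, whose underlying set is
  \<^term>\<open>unit_circle\<close> itself. Functions on the circle are functions \<^typ>\<open>complex \<Rightarrow> real\<close>,
  of which only the values on \<^term>\<open>unit_circle\<close> matter.\<close>

definition circle_borel :: "complex measure" where
  "circle_borel = restrict_space borel unit_circle"

definition circle_haar :: "complex measure" where
  "circle_haar = distr (uniform_measure lborel {0..<2 * pi}) circle_borel cis"

definition circle_prob :: "complex measure \<Rightarrow> bool" where
  "circle_prob \<mu> \<longleftrightarrow> prob_space \<mu> \<and> sets \<mu> = sets circle_borel"

definition circle_deriv :: "(complex \<Rightarrow> real) \<Rightarrow> complex \<Rightarrow> real" where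
  "circle_deriv \<phi> z = deriv (\<lambda>t::real. \<phi> (z * cis t)) 0"

definition circle_differentiable :: "(complex \<Rightarrow> real) \<Rightarrow> bool" where
  "circle_differentiable \<phi> \<longleftrightarrow>
     (\<forall>z\<in>unit_circle. (\<lambda>t::real. \<phi> (z * cis t)) field_differentiable at 0)"

primrec circle_C :: "nat \<Rightarrow> (complex \<Rightarrow> real) \<Rightarrow> bool" where
  "circle_C 0 \<phi> \<longleftrightarrow> continuous_on unit_circle \<phi>"
| "circle_C (Suc k) \<phi> \<longleftrightarrow> circle_differentiable \<phi> \<and> circle_C k (circle_deriv \<phi>)"

definition circle_smooth :: "(complex \<Rightarrow> real) \<Rightarrow> bool" where
  "circle_smooth \<phi> \<longleftrightarrow> (\<forall>k. circle_C k \<phi>)"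

definition is_smooth_density :: "complex measure \<Rightarrow> (complex \<Rightarrow> real) \<Rightarrow> bool" where
  "is_smooth_density \<mu> m \<longleftrightarrow>
     circle_smooth m \<and> (\<forall>z\<in>unit_circle. 0 \<le> m z) \<and> \<mu> = density circle_haar (\<lambda>z. ennreal (m z))"

definition smooth_measure :: "complex measure \<Rightarrow> bool" where
  "smooth_measure \<mu> \<longleftrightarrow> (\<exists>m. is_smooth_density \<mu> m)"

text \<open>The choice is harmless: a smooth density is continuous, and nonempty open arcs have positive
  Haar measure, so it is uniquely determined on the circle.\<close>

definition smooth_density :: "complex measure \<Rightarrow> complex \<Rightarrow> real" where
  "smooth_density \<mu> = (SOME m. is_smooth_density \<mu> m)"

text \<open>Since \<^term>\<open>ln (0::real) = 0\<close> by convention, the value \<open>+\<infinity>\<close> of \<open>- log |x - y|\<close> on the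
  diagonal has to be given explicitly.\<close>

definition log_kernel :: "complex \<Rightarrow> complex \<Rightarrow> ereal" where
  "log_kernel x y = (if x = y then \<infinity> else ereal (- ln (norm (x - y))))"

text \<open>The double integral of \<open>- log |x - y|\<close>, as the integral of its positive part minus the
  integral of its negative part (\<^const>\<open>e2ennreal\<close> sends negative values to 0). The kernel is at
  least \<open>- log 2\<close> on the circle, so for finite measures the second term is finite.\<close>

definition log_energy :: "complex measure \<Rightarrow> ereal" where
  "log_energy \<mu> =
     enn2ereal (\<integral>\<^sup>+ x. \<integral>\<^sup>+ y. e2ennreal (log_kernel x y) \<partial>\<mu> \<partial>\<mu>)
     - enn2ereal (\<integral>\<^sup>+ x. \<integral>\<^sup>+ y. e2ennreal (- log_kernel x y) \<partial>\<mu> \<partial>\<mu>)"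

definition energy :: "(complex \<Rightarrow> real) \<Rightarrow> complex measure \<Rightarrow> ereal" where
  "energy Q \<mu> = ereal (\<integral>x. Q x \<partial>\<mu>) + log_energy \<mu>"

definition is_energy_minimizer :: "(complex \<Rightarrow> real) \<Rightarrow> complex measure \<Rightarrow> bool" where
  "is_energy_minimizer Q \<mu> \<longleftrightarrow> circle_prob \<mu> \<and> (\<forall>\<nu>. circle_prob \<nu> \<longrightarrow> energy Q \<mu> \<le> energy Q \<nu>)"

text \<open>The principal value is taken over the interval of length \<open>2 * pi\<close> centred at \<open>x = Arg z\<close>,
  deleting a symmetric neighbourhood of \<open>x\<close>; the integrand is \<open>2 * pi\<close>-periodic.\<close>

definition circle_hilbert :: "complex measure \<Rightarrow> complex \<Rightarrow> real" where
  "circle_hilbert \<mu> z =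
     (let x = Arg z in
      Lim (at_right 0) (\<lambda>\<epsilon>. LINT y:{x - pi..x - \<epsilon>} \<union> {x + \<epsilon>..x + pi}|lborel.
        cot ((x - y) / 2) * smooth_density \<mu> (cis y) / (2 * pi)))"

definition fisher_info :: "(complex \<Rightarrow> real) \<Rightarrow> complex measure \<Rightarrow> real" where
  "fisher_info Q \<mu> =
     (\<integral>z. (circle_hilbert \<mu> z - circle_deriv Q z)\<^sup>2 \<partial>\<mu>) - (\<integral>z. circle_deriv Q z \<partial>\<mu>)\<^sup>2"

definition periodic_lift :: "complex measure \<Rightarrow> real measure" where
  "periodic_lift \<mu> = measure_of UNIV (sets borel)
     (\<lambda>A. \<integral>\<^sup>+ n. emeasure \<mu> (cis ` (A \<inter> {2 * of_int n * pi..<2 * (of_int n + 1) * pi}))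
        \<partial>count_space (UNIV :: int set))"

text \<open>The set function in \<^const>\<open>periodic_lift\<close> is countably additive, so that
  \<^const>\<open>measure_of\<close> yields a measure with these values, see \<open>emeasure_periodic_lift\<close>.\<close>

lemma Arg2pi_cis: "0 \<le> t \<Longrightarrow> t < 2 * pi \<Longrightarrow> Arg2pi (cis t) = t"
  by (rule Arg2pi_unique[of 1]) (auto simp: cis_conv_exp)

lemma cis_add_period: "cis (x + 2 * of_int n * pi) = cis x"
  using cis_multiple_2pi[of "of_int n"] by (simp add: cis_mult[symmetric] mult_ac)

lemma Arg2pi_cis_period:
  assumes "2 * of_int n * pi \<le> x" "x < 2 * (of_int n + 1) * pi"
  shows "Arg2pi (cis x) = x - 2 * of_int n * pi"
proof -
  have "Arg2pi (cis (x - 2 * of_int n * pi)) = x - 2 * of_int n * pi"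
    using assms by (intro Arg2pi_cis) (simp_all add: distrib_right)
  then show ?thesis using cis_add_period[of "x - 2 * of_int n * pi" n] by simp
qed

lemma borel_measurable_Arg2pi: "Arg2pi \<in> borel_measurable borel"
  by (rule borel_measurableI_greater) (simp add: borel_open open_Arg2pi2pi_gt)

lemma cis_image_period_sets:
  assumes "A \<in> sets borel"
  shows "cis ` (A \<inter> {2 * of_int n * pi..<2 * (of_int n + 1) * pi}) \<in> sets circle_borel"
proof -
  let ?c = "2 * of_int n * pi :: real"
  have "cis ` (A \<inter> {?c..<2 * (of_int n + 1) * pi}) = unit_circle \<inter> (\<lambda>z. Arg2pi z + ?c) -` A"
  proof (intro equalityI subsetI)
    fix z assume "z \<in> cis ` (A \<inter> {?c..<2 * (of_int n + 1) * pi})"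
    then obtain x where x: "z = cis x" "x \<in> A" "?c \<le> x" "x < 2 * (of_int n + 1) * pi" by auto
    have "Arg2pi (cis x) = x - ?c" using x by (intro Arg2pi_cis_period)
    then show "z \<in> unit_circle \<inter> (\<lambda>z. Arg2pi z + ?c) -` A" using x by simp
  next
    fix z assume z: "z \<in> unit_circle \<inter> (\<lambda>z. Arg2pi z + ?c) -` A"
    have "z = cis (Arg2pi z)" using z complex_norm_eq_1_exp[of z] by (simp add: cis_conv_exp)
    also have "\<dots> = cis (Arg2pi z + ?c)" by (rule cis_add_period[symmetric])
    finally show "z \<in> cis ` (A \<inter> {?c..<2 * (of_int n + 1) * pi})"
      using z Arg2pi[of z] by (intro image_eqI[of _ _ "Arg2pi z + ?c"]) (auto simp: algebra_simps)
  qed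
  moreover have "(\<lambda>z. Arg2pi z + ?c) -` A \<in> sets borel"
  proof -
    have "(\<lambda>z. Arg2pi z + ?c) \<in> borel_measurable borel"
      using borel_measurable_Arg2pi by measurable
    from measurable_sets[OF this assms] show ?thesis by simp
  qed
  ultimately show ?thesis
    by (auto simp: circle_borel_def sets_restrict_space)
qed

lemma inj_on_cis_period: "inj_on cis {2 * of_int n * pi..<2 * (of_int n + 1) * pi}"
  by (rule inj_on_inverseI[where g = "\<lambda>z. Arg2pi z + 2 * of_int n * pi"])
    (metis Arg2pi_cis_period atLeastLessThan_iff diff_add_cancel)

lemma emeasure_periodic_lift:
  assumes "sets \<mu> = sets circle_borel" and "A \<in> sets borel"
  shows "emeasure (periodic_lift \<mu>) A =
    (\<integral>\<^sup>+ n. emeasure \<mu> (cis ` (A \<inter> {2 * of_int n * pi..<2 * (of_int n + 1) * pi}))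
        \<partial>count_space (UNIV :: int set))"
proof (rule emeasure_measure_of[OF periodic_lift_def])
  let ?J = "\<lambda>n::int. {2 * of_int n * pi..<2 * (of_int n + 1) * pi}"
  show "countably_additive (sets (periodic_lift \<mu>)) (\<lambda>A. \<integral>\<^sup>+ n. emeasure \<mu> (cis ` (A \<inter> ?J n)) \<partial>count_space UNIV)"
  proof (rule countably_additiveI)
    fix B :: "nat \<Rightarrow> real set"
    assume B: "range B \<subseteq> sets (periodic_lift \<mu>)" "disjoint_family B" "(\<Union>i. B i) \<in> sets (periodic_lift \<mu>)"
    have sB: "B i \<in> sets borel" for i using B(1) by (auto simp: periodic_lift_def sets.sigma_sets_eq[of borel, simplified])
    have "(\<Sum>i. emeasure \<mu> (cis ` (B i \<inter> ?J n))) = emeasure \<mu> (cis ` ((\<Union>i. B i) \<inter> ?J n))" for n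
    proof -
      have "disjoint_family (\<lambda>i. cis ` (B i \<inter> ?J n))"
        using B(2) inj_on_cis_period[of n] unfolding disjoint_family_on_def inj_on_def by blast
      moreover have "(\<Union>i. cis ` (B i \<inter> ?J n)) = cis ` ((\<Union>i. B i) \<inter> ?J n)" by blast
      moreover have "range (\<lambda>i. cis ` (B i \<inter> ?J n)) \<subseteq> sets \<mu>"
        using cis_image_period_sets[OF sB] assms(1) by blast
      ultimately show ?thesis
        by (metis suminf_emeasure)
    qed
    then show "(\<Sum>i. \<integral>\<^sup>+ n. emeasure \<mu> (cis ` (B i \<inter> ?J n)) \<partial>count_space UNIV) =
       (\<integral>\<^sup>+ n. emeasure \<mu> (cis ` ((\<Union>i. B i) \<inter> ?J n)) \<partial>count_space UNIV)"
      by (subst nn_integral_suminf[symmetric]) auto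
  qed
qed (use assms in \<open>auto simp: positive_def periodic_lift_def sets.sigma_sets_eq[of borel, simplified]\<close>)

text \<open>The restriction to an interval, again as a measure on the whole real line.\<close>

definition lift_from :: "complex measure \<Rightarrow> real \<Rightarrow> real measure" where
  "lift_from \<mu> u = density (periodic_lift \<mu>) (indicator {u..<u + 2 * pi})"

definition couplings :: "real measure \<Rightarrow> real measure \<Rightarrow> (real \<times> real) measure set" where
  "couplings M N = {P. sets P = sets (borel \<Otimes>\<^sub>M borel) \<and> distr P borel fst = M \<and> distr P borel snd = N}"

definition ennreal_powr :: "ennreal \<Rightarrow> real \<Rightarrow> ennreal" where
  "ennreal_powr c r = (if c = \<infinity> then \<infinity> else ennreal (enn2real c powr r))"

definition wasserstein :: "real \<Rightarrow> real measure \<Rightarrow> real measure \<Rightarrow> ennreal" where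
  "wasserstein p M N =
     ennreal_powr (INF P\<in>couplings M N. \<integral>\<^sup>+ (x, y). ennreal (\<bar>x - y\<bar> powr p) \<partial>P) (1 / p)"

text \<open>The case distinction is needed because the supremum of the empty set is 0 in \<^typ>\<open>ennreal\<close>.\<close>

definition circle_wasserstein :: "real \<Rightarrow> complex measure \<Rightarrow> complex measure \<Rightarrow> ennreal" where
  "circle_wasserstein p \<mu> \<nu> =
     (let S = {(u, v). u \<in> {0..2 * pi} \<and> v \<in> {0..2 * pi} \<and>
                 (\<integral>x. x \<partial>lift_from \<mu> u) = (\<integral>x. x \<partial>lift_from \<nu> v)}
      in if S = {} then \<infinity> else SUP (u, v)\<in>S. wasserstein p (lift_from \<mu> u) (lift_from \<nu> v))"

end

theory Submission
  imports Defs
begin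

text \<open>Cut the circle at \<open>u\<close> and \<open>v\<close> so that the two lifts have equal means, and couple the lifts
  by their quantile functions \<open>X\<close> and \<open>Y\<close>; this coupling is optimal for the quadratic cost. With
  \<open>D = Y - X\<close>, the function \<open>- log (2 sin (t / 2)) - t\<^sup>2 / 8\<close> is convex on \<open>(0, 2\<pi>)\<close>, so the
  interaction energy lies above its tangent by at least \<open>\<integral>\<integral> (D s - D t)\<^sup>2 / 8\<close>. Since \<open>\<integral> D = 0\<close>,
  this remainder is \<open>\<integral> D\<^sup>2 / 4\<close>, which exactly compensates the \<open>- 1 / 2\<close> in the lower bound for
  \<open>Q''\<close>. The linear term is \<open>- \<integral> (H\<mu> - Q') D\<close> after symmetrisation, and as \<open>\<integral> D = 0\<close> and
  \<open>\<integral> H\<mu> d\<mu> = 0\<close> one may subtract the mean of \<open>H\<mu> - Q'\<close> before applying the Cauchy-Schwarz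
  inequality, which produces the square root of \<open>I_Q\<close>. The case of a general supremum follows by
  continuity in the Wasserstein distance.\<close>

section \<open>Lifting the circle to an arc\<close>

text \<open>The obstacle is the diagonal. The tangent inequality bounds the product of cot((X s - X
  t) / 2) and D s - D t from one side only, so the linear term is not known in advance to be
  integrable over pairs and cannot be symmetrised directly. Everything is therefore cut off near the
  diagonal by a criterion symmetric in s and t. At each level the kernel is bounded and odd,
  Fubini's theorem applies and yields a truncated Hilbert transform. The cut-off is removed at the
  end: the transform converges uniformly because the density is Lipschitz, and the energy terms
  converge by dominated convergence because finite energy makes the diagonal a null set. The 1/8 is
  half of 1/4, the minimum over (0, 2 pi) of the second derivative 1 / (4 sin^2(t/2)) of - log(2
  sin(t/2)), attained at t = pi.\<close>

definition arc_lift :: "real \<Rightarrow> complex \<Rightarrow> real" where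
  "arc_lift u z = u + Arg2pi (z * cis (- u))"

lemma arc_lift_bounds: "u \<le> arc_lift u z" "arc_lift u z < u + 2 * pi"
  using Arg2pi_ge_0[of "z * cis (- u)"] Arg2pi_lt_2pi[of "z * cis (- u)"] by (auto simp: arc_lift_def)

lemma cis_Arg2pi: "z \<in> unit_circle \<Longrightarrow> cis (Arg2pi z) = z"
  using complex_norm_eq_1_exp[of z] by (simp add: cis_conv_exp)

lemma cis_arc_lift:
  assumes "z \<in> unit_circle" shows "cis (arc_lift u z) = z"
proof -
  have "z * cis (-u) \<in> unit_circle" using assms by (simp add: norm_mult)
  then have "cis (arc_lift u z) = cis u * (z * cis (-u))"
    by (simp add: arc_lift_def cis_Arg2pi flip: cis_mult)
  also have "\<dots> = z" by (simp add: cis_mult mult.left_commute)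
  finally show ?thesis .
qed

lemma arc_lift_cis:
  assumes "u \<le> x" "x < u + 2 * pi" shows "arc_lift u (cis x) = x"
  using assms Arg2pi_cis[of "x - u"] by (simp add: arc_lift_def cis_mult)

lemma space_circle_borel [simp]: "space circle_borel = unit_circle"
  by (simp add: circle_borel_def space_restrict_space)

lemma arc_lift_measurable [measurable]: "arc_lift u \<in> borel_measurable borel"
proof -
  note borel_measurable_Arg2pi [measurable]
  show ?thesis unfolding arc_lift_def[abs_def] by measurable
qed

lemma measurable_circle_borelI: "f \<in> measurable borel N \<Longrightarrow> f \<in> measurable circle_borel N"
  unfolding circle_borel_def by (rule measurable_restrict_space1)

lemma arc_lift_measurable_circle [measurable]: "arc_lift u \<in> borel_measurable circle_borel"
  by (rule measurable_circle_borelI) measurable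

lemma cis_measurable_borel [measurable]: "cis \<in> borel_measurable borel"
  by (intro borel_measurable_continuous_onI continuous_intros)

lemma cis_measurable [measurable]: "cis \<in> measurable borel circle_borel"
  unfolding circle_borel_def by (rule measurable_restrict_space2) (auto simp: cis_measurable_borel)

lemma ex_period_index: "\<exists>n::int. 2 * of_int n * pi \<le> x \<and> x < 2 * (of_int n + 1) * pi"
proof
  let ?n = "\<lfloor>x / (2 * pi)\<rfloor>"
  have "(2 * pi) * of_int ?n \<le> (2 * pi) * (x / (2 * pi))"
    by (rule mult_left_mono) auto
  moreover have "(2 * pi) * (x / (2 * pi)) < (2 * pi) * (of_int ?n + 1)"
    by (rule mult_strict_left_mono) auto
  ultimately show "2 * of_int ?n * pi \<le> x \<and> x < 2 * (of_int ?n + 1) * pi"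
    by (simp add: mult_ac)
qed

lemma cis_image_arc: "cis ` (A \<inter> {u..<u + 2 * pi}) = arc_lift u -` A \<inter> unit_circle"
proof (intro equalityI subsetI)
  fix z assume "z \<in> cis ` (A \<inter> {u..<u + 2 * pi})"
  then obtain x where x: "z = cis x" "x \<in> A" "u \<le> x" "x < u + 2 * pi" by auto
  then show "z \<in> arc_lift u -` A \<inter> unit_circle" by (simp add: arc_lift_cis)
next
  fix z assume z: "z \<in> arc_lift u -` A \<inter> unit_circle"
  show "z \<in> cis ` (A \<inter> {u..<u + 2 * pi})"
  proof (rule image_eqI)
    show "z = cis (arc_lift u z)" using z by (simp add: cis_arc_lift)
    show "arc_lift u z \<in> A \<inter> {u..<u + 2 * pi}" using z arc_lift_bounds[of u z] by simp
  qed
qed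

text \<open>The window [u, u + 2 pi) may meet two of the periods over which
  \<open>periodic_lift\<close> sums. The pieces have disjoint images under \<open>cis\<close>, so
  the sum collapses to the measure of a single preimage under \<open>arc_lift u\<close>. From here
  on the lifts are handled as laws of real random variables.\<close>

lemma lift_from_eq_distr:
  assumes "circle_prob \<mu>"
  shows "lift_from \<mu> u = distr \<mu> borel (arc_lift u)"
proof (rule measure_eqI)
  have sets: "sets \<mu> = sets circle_borel" using assms by (simp add: circle_prob_def)
  then have space: "space \<mu> = unit_circle" using sets_eq_imp_space_eq[OF sets] by simp
  have sp: "sets (periodic_lift \<mu>) = sets borel"
    by (simp add: periodic_lift_def sets.sigma_sets_eq[of borel, simplified])
  show "sets (lift_from \<mu> u) = sets (distr \<mu> borel (arc_lift u))"
    by (simp add: lift_from_def sp)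
  fix A assume "A \<in> sets (lift_from \<mu> u)"
  then have A [measurable]: "A \<in> sets borel" by (simp add: lift_from_def sp)
  let ?J = "\<lambda>n::int. {2 * of_int n * pi..<2 * (of_int n + 1) * pi}"
  let ?A = "A \<inter> {u..<u + 2 * pi}"
  have m1: "(\<lambda>x. indicator {u..<u + 2 * pi} x :: ennreal) \<in> borel_measurable (periodic_lift \<mu>)"
    unfolding measurable_cong_sets[OF sp refl] by measurable
  have "emeasure (lift_from \<mu> u) A = (\<integral>\<^sup>+x. indicator {u..<u + 2 * pi} x * indicator A x \<partial>periodic_lift \<mu>)"
    unfolding lift_from_def by (rule emeasure_density[OF m1]) (simp add: sp)
  also have "\<dots> = (\<integral>\<^sup>+x. indicator ?A x \<partial>periodic_lift \<mu>)"
    by (intro nn_integral_cong) (auto simp: indicator_def)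
  also have "\<dots> = emeasure (periodic_lift \<mu>) ?A"
    by (rule nn_integral_indicator) (simp add: sp)
  also have "\<dots> = (\<integral>\<^sup>+ n. emeasure \<mu> (cis ` (?A \<inter> ?J n)) \<partial>count_space UNIV)"
    by (rule emeasure_periodic_lift[OF sets]) measurable
  also have "\<dots> = emeasure \<mu> (\<Union>n. cis ` (?A \<inter> ?J n))"
  proof (rule emeasure_UN_countable[symmetric])
    show "cis ` (?A \<inter> ?J n) \<in> sets \<mu>" for n
      unfolding sets by (rule cis_image_period_sets) measurable
    show "disjoint_family_on (\<lambda>n. cis ` (?A \<inter> ?J n)) UNIV"
    proof (unfold disjoint_family_on_def, safe)
      fix m n :: int and x y
      assume "m \<noteq> n" and x: "x \<in> A" "x \<in> {u..<u + 2 * pi}" "x \<in> ?J m"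
        and y: "y \<in> A" "y \<in> {u..<u + 2 * pi}" "y \<in> ?J n" and e: "cis x = cis y"
      \<comment> \<open>Injectivity of \<open>cis\<close> on the window turns equal images into
        equal points, and a point lies in only one period.\<close>
      have "x = y"
        using arc_lift_cis[of u x] arc_lift_cis[of u y] x(2) y(2) e by (metis atLeastLessThan_iff)
      then have "2 * of_int m * pi \<le> x" "x < 2 * (of_int m + 1) * pi"
        "2 * of_int n * pi \<le> x" "x < 2 * (of_int n + 1) * pi"
        using x(3) y(3) by (simp_all only: atLeastLessThan_iff)
      then have "2 * of_int m * pi < 2 * (of_int n + 1) * pi" "2 * of_int n * pi < 2 * (of_int m + 1) * pi"
        by (meson le_less_trans)+
      then have "(of_int m::real) < of_int n + 1" "(of_int n::real) < of_int m + 1"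
        by (simp_all only: mult_less_cancel_right_pos[OF pi_gt_zero] mult_less_cancel_left_pos zero_less_numeral)
      then show "cis x \<in> {}" using \<open>m \<noteq> n\<close> by linarith
    qed
  qed auto
  also have "(\<Union>n. cis ` (?A \<inter> ?J n)) = cis ` ?A"
  proof -
    have a: "\<forall>x. \<exists>n. x \<in> ?J n"
      using ex_period_index by (simp only: atLeastLessThan_iff) blast
    have b: "(\<Union>n. cis ` (B \<inter> J n)) = cis ` B" if "\<forall>x. \<exists>n. x \<in> J n" for J :: "int \<Rightarrow> real set" and B
      using that by blast
    show ?thesis by (rule b[OF a])
  qed
  also have "cis ` ?A = arc_lift u -` A \<inter> space \<mu>"
    unfolding space by (rule cis_image_arc)
  also have "emeasure \<mu> (arc_lift u -` A \<inter> space \<mu>) = emeasure (distr \<mu> borel (arc_lift u)) A"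
    by (rule emeasure_distr[symmetric]) (simp_all add: measurable_cong_sets[OF sets refl])
  finally show "emeasure (lift_from \<mu> u) A = emeasure (distr \<mu> borel (arc_lift u)) A" .
qed

section \<open>Haar measure in an arbitrary angular window\<close>

lemma nn_integral_lborel_shift:
  fixes h :: "real \<Rightarrow> ennreal"
  assumes [measurable]: "h \<in> borel_measurable borel"
  shows "(\<integral>\<^sup>+x. h (x + c) * indicator {a..<b} x \<partial>lborel) = (\<integral>\<^sup>+x. h x * indicator {a + c..<b + c} x \<partial>lborel)"
proof -
  have "(\<integral>\<^sup>+x. h x * indicator {a + c..<b + c} x \<partial>lborel) =
     (\<integral>\<^sup>+x. h (c + 1 * x) * indicator {a + c..<b + c} (c + 1 * x) \<partial>lborel)"
    by (subst nn_integral_real_affine[of _ 1 c]) auto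
  also have "\<dots> = (\<integral>\<^sup>+x. h (x + c) * indicator {a..<b} x \<partial>lborel)"
    by (intro nn_integral_cong) (auto simp: indicator_def add.commute)
  finally show ?thesis ..
qed

text \<open>Windows at most one period apart differ by [a, b), which is exchanged for its translate
  by 2 pi. A remote window is first approached by whole periods until this applies.\<close>

lemma nn_integral_periodic:
  fixes h :: "real \<Rightarrow> ennreal"
  assumes [measurable]: "h \<in> borel_measurable borel" and per: "\<And>x. h (x + 2 * pi) = h x"
  shows "(\<integral>\<^sup>+x. h x * indicator {a..<a + 2 * pi} x \<partial>lborel) = (\<integral>\<^sup>+x. h x * indicator {b..<b + 2 * pi} x \<partial>lborel)"
proof -
  have near: "(\<integral>\<^sup>+x. h x * indicator {a..<a + 2 * pi} x \<partial>lborel) = (\<integral>\<^sup>+x. h x * indicator {b..<b + 2 * pi} x \<partial>lborel)"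
    if "a \<le> b" "b \<le> a + 2 * pi" for a b
  proof -
    have *: "(\<integral>\<^sup>+x. h x * indicator {p..<q} x \<partial>lborel) + (\<integral>\<^sup>+x. h x * indicator {q..<r} x \<partial>lborel)
       = (\<integral>\<^sup>+x. h x * indicator {p..<r} x \<partial>lborel)" if "p \<le> q" "q \<le> r" for p q r
      using that by (subst nn_integral_add[symmetric]) (auto intro!: nn_integral_cong simp: indicator_def)
    have "(\<integral>\<^sup>+x. h x * indicator {a..<a + 2 * pi} x \<partial>lborel) =
       (\<integral>\<^sup>+x. h x * indicator {b..<a + 2 * pi} x \<partial>lborel) + (\<integral>\<^sup>+x. h x * indicator {a..<b} x \<partial>lborel)"
      using *[of a b "a + 2 * pi"] that by (simp add: add.commute)
    also have "(\<integral>\<^sup>+x. h x * indicator {a..<b} x \<partial>lborel) = (\<integral>\<^sup>+x. h x * indicator {a + 2 * pi..<b + 2 * pi} x \<partial>lborel)"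
      using nn_integral_lborel_shift[of h "2 * pi" a b] by (simp add: per)
    finally show ?thesis using *[of b "a + 2 * pi" "b + 2 * pi"] that by simp
  qed
  have *: "(\<integral>\<^sup>+x. h x * indicator {a..<a + 2 * pi} x \<partial>lborel) =
      (\<integral>\<^sup>+x. h x * indicator {a + 2 * pi * of_nat n..<a + 2 * pi * of_nat n + 2 * pi} x \<partial>lborel)" for a n
  proof (induction n)
    case (Suc n)
    have e: "a + 2 * pi * of_nat (Suc n) = a + 2 * pi * of_nat n + 2 * pi" by (simp add: distrib_left)
    show ?case unfolding e Suc by (rule near) auto
  qed simp
  have "(\<integral>\<^sup>+x. h x * indicator {a..<a + 2 * pi} x \<partial>lborel) = (\<integral>\<^sup>+x. h x * indicator {b..<b + 2 * pi} x \<partial>lborel)"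
    if "a \<le> b" for a b
  proof -
    let ?n = "nat \<lfloor>(b - a) / (2 * pi)\<rfloor>"
    define q where "q = (b - a) / (2 * pi)"
    have "0 \<le> q" using that by (simp add: q_def)
    then have q: "real (nat \<lfloor>q\<rfloor>) \<le> q" "q \<le> real (nat \<lfloor>q\<rfloor>) + 1" by linarith+
    have "2 * pi * real (nat \<lfloor>q\<rfloor>) \<le> 2 * pi * q" "2 * pi * q \<le> 2 * pi * (real (nat \<lfloor>q\<rfloor>) + 1)"
      by (rule mult_left_mono[OF q(1)], simp) (rule mult_left_mono[OF q(2)], simp)
    moreover have "2 * pi * q = b - a" by (simp add: q_def)
    moreover have "2 * pi * (real (nat \<lfloor>q\<rfloor>) + 1) = 2 * pi * real (nat \<lfloor>q\<rfloor>) + 2 * pi"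
      by (simp only: distrib_left mult_1_right)
    ultimately have "a + 2 * pi * real ?n \<le> b" "b \<le> a + 2 * pi * real ?n + 2 * pi"
      unfolding q_def[symmetric] by linarith+
    from near[OF this] show ?thesis by (simp only: *[of a ?n])
  qed
  from this[of a b] this[of b a, symmetric] show ?thesis by (rule linorder_le_cases)
qed

text \<open>The start \<open>a\<close> of the window is free so that a singularity can be put in its
  middle: the logarithmic and the cotangent kernel at an angle x are both integrated over the window
  starting at x - pi.\<close>

lemma density_circle_haar_eq_distr:
  fixes m :: "complex \<Rightarrow> real"
  assumes m [measurable]: "m \<in> borel_measurable circle_borel" and nn: "\<And>z. z \<in> unit_circle \<Longrightarrow> 0 \<le> m z"
  shows "density circle_haar (\<lambda>z. ennreal (m z)) =
    distr (density lborel (\<lambda>t. ennreal (m (cis t) / (2 * pi) * indicator {a..<a + 2 * pi} t))) circle_borel cis"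
    (is "?L = ?R")
proof (rule measure_eqI)
  have sh: "sets circle_haar = sets circle_borel" by (simp add: circle_haar_def)
  show "sets ?L = sets ?R" by (simp add: sh)
  fix A assume "A \<in> sets ?L"
  then have A [measurable]: "A \<in> sets circle_borel" by (simp add: sh)
  have m': "(\<lambda>z. ennreal (m z)) \<in> borel_measurable circle_haar"
    by (simp add: measurable_cong_sets[OF sh refl])
  define h where "h t = ennreal (m (cis t)) * indicator A (cis t)" for t
  have [measurable]: "h \<in> borel_measurable borel" unfolding h_def by measurable
  have per: "h (x + 2 * pi) = h x" for x
    using cis_add_period[of x 1] unfolding h_def by (simp only: of_int_1 mult_1_right)
  have "emeasure ?L A = (\<integral>\<^sup>+z. ennreal (m z) * indicator A z \<partial>circle_haar)"
    by (rule emeasure_density[OF m']) (simp add: sh)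
  also have "\<dots> = (\<integral>\<^sup>+t. h t \<partial>uniform_measure lborel {0..<2 * pi})"
    unfolding circle_haar_def by (subst nn_integral_distr) (auto simp: h_def intro!: nn_integral_cong)
  also have "\<dots> = (\<integral>\<^sup>+t. h t * indicator {0..<2 * pi} t \<partial>lborel) / ennreal (2 * pi)"
    by (subst nn_integral_uniform_measure) simp_all
  also have "(\<integral>\<^sup>+t. h t * indicator {0..<2 * pi} t \<partial>lborel) = (\<integral>\<^sup>+t. h t * indicator {a..<a + 2 * pi} t \<partial>lborel)"
    using nn_integral_periodic[OF \<open>h \<in> _\<close> per, of 0 a] by (simp only: add_0_left)
  also have "\<dots> / ennreal (2 * pi) = (\<integral>\<^sup>+t. h t * indicator {a..<a + 2 * pi} t / ennreal (2 * pi) \<partial>lborel)"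
    by (subst nn_integral_divide) auto
  also have "\<dots> = (\<integral>\<^sup>+t. ennreal (m (cis t) / (2 * pi) * indicator {a..<a + 2 * pi} t) * indicator (cis -` A) t \<partial>lborel)"
    using nn by (intro nn_integral_cong) (auto simp: h_def indicator_def divide_ennreal)
  also have "\<dots> = emeasure (density lborel (\<lambda>t. ennreal (m (cis t) / (2 * pi) * indicator {a..<a + 2 * pi} t))) (cis -` A)"
    using measurable_sets[OF cis_measurable A] by (subst emeasure_density) auto
  also have "\<dots> = emeasure ?R A"
    by (subst emeasure_distr) auto
  finally show "emeasure ?L A = emeasure ?R A" .
qed

section \<open>Comonotone couplings\<close>

text \<open>Since \<open>ennreal\<close> cuts at 0, each factor is the length of the set of
  nonnegative levels below it, and Tonelli's theorem moves the integral over the sample space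
  inside. This reduces the comparison of product moments to that of joint tail
  probabilities.\<close>

lemma nn_integral_layer_cake_mult:
  fixes A B :: "'a \<Rightarrow> real"
  assumes "prob_space N" and [measurable]: "A \<in> borel_measurable N" "B \<in> borel_measurable N"
  shows "(\<integral>\<^sup>+\<omega>. ennreal (A \<omega>) * ennreal (B \<omega>) \<partial>N) =
    (\<integral>\<^sup>+a. (\<integral>\<^sup>+b. emeasure N {\<omega> \<in> space N. a < A \<omega> \<and> b < B \<omega>} * indicator {0..} b \<partial>lborel) * indicator {0..} a \<partial>lborel)"
proof -
  interpret prob_space N by fact
  interpret P: pair_sigma_finite N "lborel :: real measure" ..
  define f where "f \<omega> a b = (if a < A \<omega> \<and> b < B \<omega> \<and> 0 \<le> a \<and> 0 \<le> b then 1 else 0 :: ennreal)" for \<omega> a b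
  have len: "(\<integral>\<^sup>+a. indicator {0..<r} a \<partial>lborel) = ennreal r" for r :: real
    by (cases "0 \<le> r") (auto simp: ennreal_neg)
  have "(\<integral>\<^sup>+\<omega>. ennreal (A \<omega>) * ennreal (B \<omega>) \<partial>N) = (\<integral>\<^sup>+\<omega>. \<integral>\<^sup>+a. \<integral>\<^sup>+b. f \<omega> a b \<partial>lborel \<partial>lborel \<partial>N)"
  proof (intro nn_integral_cong)
    fix \<omega>
    have "f \<omega> a b = indicator {0..<A \<omega>} a * indicator {0..<B \<omega>} b" for a b
      by (auto simp: f_def indicator_def)
    then show "ennreal (A \<omega>) * ennreal (B \<omega>) = (\<integral>\<^sup>+a. \<integral>\<^sup>+b. f \<omega> a b \<partial>lborel \<partial>lborel)"
      by (simp add: nn_integral_cmult nn_integral_multc len del: nn_integral_indicator nn_integral_indicator')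
  qed
  also have "\<dots> = (\<integral>\<^sup>+a. \<integral>\<^sup>+\<omega>. \<integral>\<^sup>+b. f \<omega> a b \<partial>lborel \<partial>N \<partial>lborel)"
    by (rule P.Fubini'[symmetric]) (unfold f_def, measurable)
  also have "\<dots> = (\<integral>\<^sup>+a. \<integral>\<^sup>+b. \<integral>\<^sup>+\<omega>. f \<omega> a b \<partial>N \<partial>lborel \<partial>lborel)"
    by (intro nn_integral_cong P.Fubini'[symmetric]) (unfold f_def, measurable)
  also have "\<dots> = (\<integral>\<^sup>+a. (\<integral>\<^sup>+b. emeasure N {\<omega> \<in> space N. a < A \<omega> \<and> b < B \<omega>} * indicator {0..} b \<partial>lborel) * indicator {0..} a \<partial>lborel)"
  proof (intro nn_integral_cong)
    fix a :: real
    have "(\<integral>\<^sup>+\<omega>. f \<omega> a b \<partial>N) = emeasure N {\<omega> \<in> space N. a < A \<omega> \<and> b < B \<omega>} * indicator {0..} b * indicator {0..} a" for b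
    proof -
      have "(\<integral>\<^sup>+\<omega>. f \<omega> a b \<partial>N) = (\<integral>\<^sup>+\<omega>. indicator {\<omega> \<in> space N. a < A \<omega> \<and> b < B \<omega>} \<omega> * (indicator {0..} b * indicator {0..} a) \<partial>N)"
        by (intro nn_integral_cong) (auto simp: f_def indicator_def)
      also have "\<dots> = emeasure N {\<omega> \<in> space N. a < A \<omega> \<and> b < B \<omega>} * (indicator {0..} b * indicator {0..} a)"
        by (subst nn_integral_multc) auto
      finally show ?thesis by (simp add: mult.assoc)
    qed
    then show "(\<integral>\<^sup>+b. \<integral>\<^sup>+\<omega>. f \<omega> a b \<partial>N \<partial>lborel) = (\<integral>\<^sup>+b. emeasure N {\<omega> \<in> space N. a < A \<omega> \<and> b < B \<omega>} * indicator {0..} b \<partial>lborel) * indicator {0..} a"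
      by (simp add: nn_integral_multc)
  qed
  finally show ?thesis .
qed

text \<open>The condition is symmetric in \<open>X\<close> and \<open>Y\<close>, as its
  contrapositive exchanges them, and it means that any upper level set of \<open>X\<close> and any
  upper level set of \<open>Y\<close> are nested. No order on the sample space is involved.\<close>

definition comonotone_on :: "'a set \<Rightarrow> ('a \<Rightarrow> real) \<Rightarrow> ('a \<Rightarrow> real) \<Rightarrow> bool" where
  "comonotone_on S X Y \<longleftrightarrow> (\<forall>s\<in>S. \<forall>t\<in>S. X s < X t \<longrightarrow> Y s \<le> Y t)"

text \<open>A joint tail never exceeds the smaller of its two marginal tails, and nested level sets
  attain this bound. Equal marginals make the bound the same for both pairs.\<close>

lemma nn_integral_mult_le_comonotone:
  fixes A B :: "'a \<Rightarrow> real" and X Y :: "'b \<Rightarrow> real"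
  assumes N: "prob_space N" and [measurable]: "A \<in> borel_measurable N" "B \<in> borel_measurable N"
    and M: "prob_space M" and [measurable]: "X \<in> borel_measurable M" "Y \<in> borel_measurable M"
    and comon: "comonotone_on (space M) X Y"
    and AX: "distr N borel A = distr M borel X" and BY: "distr N borel B = distr M borel Y"
  shows "(\<integral>\<^sup>+\<omega>. ennreal (A \<omega>) * ennreal (B \<omega>) \<partial>N) \<le> (\<integral>\<^sup>+\<omega>. ennreal (X \<omega>) * ennreal (Y \<omega>) \<partial>M)"
proof -
  have le: "emeasure N {\<omega> \<in> space N. a < A \<omega> \<and> b < B \<omega>} \<le> emeasure M {\<omega> \<in> space M. a < X \<omega> \<and> b < Y \<omega>}" for a b
  proof -
    have tailA: "emeasure N {\<omega> \<in> space N. a < A \<omega>} = emeasure M {\<omega> \<in> space M. a < X \<omega>}"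
      using arg_cong[OF AX, of "\<lambda>P. emeasure P {a<..}"]
      by (simp add: emeasure_distr vimage_def Int_def conj_commute)
    have tailB: "emeasure N {\<omega> \<in> space N. b < B \<omega>} = emeasure M {\<omega> \<in> space M. b < Y \<omega>}"
      using arg_cong[OF BY, of "\<lambda>P. emeasure P {b<..}"]
      by (simp add: emeasure_distr vimage_def Int_def conj_commute)
    have "{\<omega> \<in> space M. a < X \<omega>} \<subseteq> {\<omega> \<in> space M. b < Y \<omega>} \<or>
      {\<omega> \<in> space M. b < Y \<omega>} \<subseteq> {\<omega> \<in> space M. a < X \<omega>}"
    proof (rule ccontr)
      assume "\<not> ?thesis"
      then obtain s t where "s \<in> space M" "a < X s" "\<not> b < Y s" "t \<in> space M" "b < Y t" "\<not> a < X t"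
        by blast
      then show False using comon unfolding comonotone_on_def by force
    qed
    then consider "{\<omega> \<in> space M. a < X \<omega>} \<subseteq> {\<omega> \<in> space M. b < Y \<omega>}" | "{\<omega> \<in> space M. b < Y \<omega>} \<subseteq> {\<omega> \<in> space M. a < X \<omega>}"
      by blast
    then show ?thesis
    proof cases
      case 1
      then have "{\<omega> \<in> space M. a < X \<omega> \<and> b < Y \<omega>} = {\<omega> \<in> space M. a < X \<omega>}" by auto
      then show ?thesis using tailA by (auto intro!: emeasure_mono simp flip: tailA)
    next
      case 2
      then have "{\<omega> \<in> space M. a < X \<omega> \<and> b < Y \<omega>} = {\<omega> \<in> space M. b < Y \<omega>}" by auto
      then show ?thesis using tailB by (auto intro!: emeasure_mono simp flip: tailB)
    qed
  qed
  show ?thesis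
    unfolding nn_integral_layer_cake_mult[OF N assms(2,3)] nn_integral_layer_cake_mult[OF M assms(5,6)]
    by (intro nn_integral_mono mult_right_mono le) auto
qed

text \<open>Expanding the square leaves the second moments, which the marginals fix, and minus twice
  the product moment, which the comonotone pair maximises. The range [0, K] gives integrability and
  ensures that \<open>ennreal\<close> discards nothing in the product comparison.\<close>

lemma wasserstein_2_comonotone:
  fixes X Y :: "'b \<Rightarrow> real"
  assumes M: "prob_space M" and [measurable]: "X \<in> borel_measurable M" "Y \<in> borel_measurable M"
    and comon: "comonotone_on (space M) X Y"
    and bX: "AE \<omega> in M. 0 \<le> X \<omega> \<and> X \<omega> \<le> K" and bY: "AE \<omega> in M. 0 \<le> Y \<omega> \<and> Y \<omega> \<le> K"
  shows "wasserstein 2 (distr M borel X) (distr M borel Y) = ennreal (sqrt (\<integral>\<omega>. (Y \<omega> - X \<omega>)\<^sup>2 \<partial>M))"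
proof -
  let ?C = "couplings (distr M borel X) (distr M borel Y)"
  let ?cost = "\<lambda>P. \<integral>\<^sup>+ (x, y). ennreal (\<bar>x - y\<bar> powr 2) \<partial>P"
  interpret M: prob_space M by fact
  have int: "integrable M (\<lambda>\<omega>. (X \<omega>)\<^sup>2)" "integrable M (\<lambda>\<omega>. (Y \<omega>)\<^sup>2)" "integrable M (\<lambda>\<omega>. X \<omega> * Y \<omega>)"
    by (rule M.integrable_const_bound[where B = "K * K"];
      use bX bY in \<open>auto simp: power2_eq_square abs_mult intro!: mult_mono elim!: AE_mp\<close>)+
  have "?cost P \<ge> ennreal (\<integral>\<omega>. (Y \<omega> - X \<omega>)\<^sup>2 \<partial>M)" if "P \<in> ?C" for P
  proof -
    have sP: "sets P = sets (borel \<Otimes>\<^sub>M borel)" and fP: "distr P borel fst = distr M borel X"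
      and gP: "distr P borel snd = distr M borel Y" using that by (auto simp: couplings_def)
    have mf [measurable]: "fst \<in> borel_measurable P" "snd \<in> borel_measurable P"
      unfolding measurable_cong_sets[OF sP refl] by auto
    \<comment> \<open>\<open>couplings\<close> does not mention the total mass; it is inherited from
      the first marginal.\<close>
    have P: "prob_space P"
    proof (rule prob_space_distrD[OF mf(1)])
      show "prob_space (distr P borel fst)" unfolding fP by (rule M.prob_space_distr) simp
    qed
    then interpret P: prob_space P .
    have bf: "AE p in P. 0 \<le> fst p \<and> fst p \<le> K"
    proof -
      have "AE x in distr P borel fst. 0 \<le> x \<and> x \<le> K" unfolding fP using bX by (subst AE_distr_iff) auto
      then show ?thesis by (subst (asm) AE_distr_iff) auto
    qed
    have bs: "AE p in P. 0 \<le> snd p \<and> snd p \<le> K"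
    proof -
      have "AE x in distr P borel snd. 0 \<le> x \<and> x \<le> K" unfolding gP using bY by (subst AE_distr_iff) auto
      then show ?thesis by (subst (asm) AE_distr_iff) auto
    qed
    have intP: "integrable P (\<lambda>p. (fst p)\<^sup>2)" "integrable P (\<lambda>p. (snd p)\<^sup>2)" "integrable P (\<lambda>p. fst p * snd p)"
      by (rule P.integrable_const_bound[where B = "K * K"];
        use bf bs in \<open>auto simp: power2_eq_square abs_mult intro!: mult_mono elim!: AE_mp\<close>)+
    have sqf: "(\<integral>p. (fst p)\<^sup>2 \<partial>P) = (\<integral>\<omega>. (X \<omega>)\<^sup>2 \<partial>M)"
      using arg_cong[OF fP, of "\<lambda>D. \<integral>x. x\<^sup>2 \<partial>D"] by (simp add: integral_distr)
    have sqs: "(\<integral>p. (snd p)\<^sup>2 \<partial>P) = (\<integral>\<omega>. (Y \<omega>)\<^sup>2 \<partial>M)"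
      using arg_cong[OF gP, of "\<lambda>D. \<integral>x. x\<^sup>2 \<partial>D"] by (simp add: integral_distr)
    have "ennreal (\<integral>p. fst p * snd p \<partial>P) \<le> ennreal (\<integral>\<omega>. X \<omega> * Y \<omega> \<partial>M)"
    proof -
      have "ennreal (\<integral>p. fst p * snd p \<partial>P) = (\<integral>\<^sup>+p. ennreal (fst p) * ennreal (snd p) \<partial>P)"
        using bf bs by (subst nn_integral_eq_integral[symmetric, OF intP(3)])
          (auto intro!: nn_integral_cong_AE simp: ennreal_mult' elim!: AE_mp)
      also have "\<dots> \<le> (\<integral>\<^sup>+\<omega>. ennreal (X \<omega>) * ennreal (Y \<omega>) \<partial>M)"
        by (rule nn_integral_mult_le_comonotone[OF P _ _ M _ _ comon fP gP]) auto
      also have "\<dots> = ennreal (\<integral>\<omega>. X \<omega> * Y \<omega> \<partial>M)"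
        using bX bY by (subst nn_integral_eq_integral[symmetric, OF int(3)])
          (auto intro!: nn_integral_cong_AE simp: ennreal_mult' elim!: AE_mp)
      finally show ?thesis .
    qed
    moreover have "0 \<le> (\<integral>\<omega>. X \<omega> * Y \<omega> \<partial>M)"
      by (rule integral_nonneg_AE) (use bX bY in eventually_elim, auto)
    ultimately have prod: "(\<integral>p. fst p * snd p \<partial>P) \<le> (\<integral>\<omega>. X \<omega> * Y \<omega> \<partial>M)"
      by (simp add: ennreal_le_iff)
    have "(\<integral>\<omega>. (Y \<omega> - X \<omega>)\<^sup>2 \<partial>M) = (\<integral>\<omega>. (Y \<omega>)\<^sup>2 \<partial>M) + (\<integral>\<omega>. (X \<omega>)\<^sup>2 \<partial>M) - 2 * (\<integral>\<omega>. X \<omega> * Y \<omega> \<partial>M)"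
      using int by (simp add: power2_diff mult.assoc mult.commute[of "Y _"])
    also have "\<dots> \<le> (\<integral>p. (snd p)\<^sup>2 \<partial>P) + (\<integral>p. (fst p)\<^sup>2 \<partial>P) - 2 * (\<integral>p. fst p * snd p \<partial>P)"
      using prod by (simp add: sqf sqs)
    also have "\<dots> = (\<integral>p. (fst p - snd p)\<^sup>2 \<partial>P)"
      using intP by (simp add: power2_diff mult.assoc)
    finally have "ennreal (\<integral>\<omega>. (Y \<omega> - X \<omega>)\<^sup>2 \<partial>M) \<le> ennreal (\<integral>p. (fst p - snd p)\<^sup>2 \<partial>P)"
      by (rule ennreal_leI)
    also have "\<dots> = (\<integral>\<^sup>+p. ennreal ((fst p - snd p)\<^sup>2) \<partial>P)"
    proof (rule nn_integral_eq_integral[symmetric])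
      show "integrable P (\<lambda>p. (fst p - snd p)\<^sup>2)" using intP by (simp add: power2_diff mult.assoc)
    qed simp
    also have "\<dots> = ?cost P" by (intro nn_integral_cong) (auto split: prod.split)
    finally show ?thesis .
  qed
  moreover have "\<exists>P\<in>?C. ?cost P = ennreal (\<integral>\<omega>. (Y \<omega> - X \<omega>)\<^sup>2 \<partial>M)"
  proof
    let ?P = "distr M (borel \<Otimes>\<^sub>M borel) (\<lambda>\<omega>. (X \<omega>, Y \<omega>))"
    show "?P \<in> ?C" by (auto simp: couplings_def distr_distr comp_def)
    have "?cost ?P = (\<integral>\<^sup>+\<omega>. ennreal ((Y \<omega> - X \<omega>)\<^sup>2) \<partial>M)"
      by (subst nn_integral_distr) (auto intro!: nn_integral_cong simp: power2_commute)
    also have "\<dots> = ennreal (\<integral>\<omega>. (Y \<omega> - X \<omega>)\<^sup>2 \<partial>M)"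
    proof (rule nn_integral_eq_integral)
      show "integrable M (\<lambda>\<omega>. (Y \<omega> - X \<omega>)\<^sup>2)"
        using int by (simp add: power2_diff mult.assoc mult.commute[of "Y _"])
    qed simp
    finally show "?cost ?P = ennreal (\<integral>\<omega>. (Y \<omega> - X \<omega>)\<^sup>2 \<partial>M)" .
  qed
  ultimately have "(INF P\<in>?C. ?cost P) = ennreal (\<integral>\<omega>. (Y \<omega> - X \<omega>)\<^sup>2 \<partial>M)"
    by (intro antisym INF_greatest) (auto intro: INF_lower2)
  then show ?thesis
    by (simp add: wasserstein_def ennreal_powr_def powr_half_sqrt)
qed

text \<open>Both laws are realised on (0, 1) with Lebesgue measure by their generalised inverse
  distribution functions \<open>I\<close>. Two nondecreasing functions of the same variable are
  comonotone.\<close>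

lemma ex_comonotone_coupling:
  assumes "real_distribution M" "real_distribution N"
  shows "\<exists>(\<Omega> :: real measure) X Y. prob_space \<Omega> \<and> X \<in> borel_measurable \<Omega> \<and> Y \<in> borel_measurable \<Omega> \<and>
    distr \<Omega> borel X = M \<and> distr \<Omega> borel Y = N \<and> comonotone_on (space \<Omega>) X Y"
proof -
  interpret M: cdf_distribution M using assms(1) by (simp add: cdf_distribution_def)
  interpret N: cdf_distribution N using assms(2) by (simp add: cdf_distribution_def)
  let ?\<Omega> = "restrict_space lborel {0<..<1} :: real measure"
  have "prob_space ?\<Omega>"
    by (auto simp: space_restrict_space emeasure_restrict_space intro!: prob_spaceI)
  moreover have "M.I \<in> borel_measurable ?\<Omega>" "N.I \<in> borel_measurable ?\<Omega>"
    using M.measurable_CI N.measurable_CI by (simp_all cong: measurable_cong_sets)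
  moreover have "comonotone_on (space ?\<Omega>) M.I N.I"
  proof (unfold comonotone_on_def, intro ballI impI)
    fix s t assume st: "s \<in> space ?\<Omega>" "t \<in> space ?\<Omega>" "M.I s < M.I t"
    then have *: "s \<in> {0<..<1}" "t \<in> {0<..<1}" by (auto simp: space_restrict_space)
    have "s \<le> t"
      using mono_onD[OF M.mono_I *(2,1)] st(3) by (meson linorder_le_cases not_less)
    then show "N.I s \<le> N.I t" using mono_onD[OF N.mono_I *] by simp
  qed
  ultimately show ?thesis using M.distr_I_eq_M N.distr_I_eq_M by blast
qed

section \<open>Logarithmic energy\<close>

lemma norm_cis_diff: "norm (cis a - cis b) = 2 * \<bar>sin ((a - b) / 2)\<bar>"
proof -
  have "(norm (cis a - cis b))\<^sup>2 = (cos a - cos b)\<^sup>2 + (sin a - sin b)\<^sup>2"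
    by (simp add: cmod_power2)
  also have "\<dots> = ((sin a)\<^sup>2 + (cos a)\<^sup>2) + ((sin b)\<^sup>2 + (cos b)\<^sup>2) - 2 * (cos a * cos b + sin a * sin b)"
    by (simp only: power2_diff) (simp add: algebra_simps)
  also have "\<dots> = 2 - 2 * cos (a - b)"
    by (simp add: cos_diff)
  also have "a - b = 2 * ((a - b) / 2)" by simp
  also have "2 - 2 * cos (2 * ((a - b) / 2)) = (2 * \<bar>sin ((a - b) / 2)\<bar>)\<^sup>2"
    unfolding cos_double_sin by (simp add: power_mult_distrib)
  finally show ?thesis by (rule power2_eq_imp_eq) auto
qed

text \<open>Here sin x = 2 tan(x/2) cos^2(x/2), where tan(x/2) is at least x/2 and cos^2(x/2) = (1 +
  cos x) / 2 is at least 1/2. The constant is weaker than Jordan's 2/pi, but only the order of the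
  singularity matters later.\<close>

lemma half_le_sin:
  assumes "0 \<le> x" "x \<le> pi / 2" shows "x / 2 \<le> sin x"
proof -
  have c: "0 < cos (x / 2)" using assms pi_gt_zero by (intro cos_gt_zero_pi) linarith+
  have "\<bar>x / 2\<bar> \<le> \<bar>tan (x / 2)\<bar>" using assms pi_gt_zero by (intro abs_tan_ge) (auto simp: abs_if simp del: pi_gt_zero)
  moreover have "0 \<le> tan (x / 2)"
    using assms c by (auto simp: tan_def intro!: divide_nonneg_nonneg sin_ge_zero)
  ultimately have "x / 2 \<le> tan (x / 2)" using assms by simp
  then have "x / 2 * cos (x / 2) \<le> sin (x / 2)"
    using c by (simp add: tan_def pos_le_divide_eq)
  then have "2 * (x / 2 * cos (x / 2)) * cos (x / 2) \<le> 2 * sin (x / 2) * cos (x / 2)"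
    using c by (intro mult_right_mono mult_left_mono) auto
  also have "\<dots> = sin x" using sin_double[of "x / 2"] by simp
  finally have "x * (cos (x / 2))\<^sup>2 \<le> sin x" by (simp add: power2_eq_square mult.assoc)
  moreover have "1 / 2 \<le> (cos (x / 2))\<^sup>2"
    using cos_double_cos[of "x / 2"] cos_ge_zero[of x] assms by simp
  then have "x * (1 / 2) \<le> x * (cos (x / 2))\<^sup>2" using assms(1) by (rule mult_left_mono)
  ultimately show ?thesis by simp
qed

lemma abs_le_abs_sin_half:
  assumes "\<bar>r\<bar> \<le> pi" shows "\<bar>r\<bar> / 4 \<le> \<bar>sin (r / 2)\<bar>"
proof -
  have "\<bar>r\<bar> / 2 / 2 \<le> sin (\<bar>r\<bar> / 2)" using assms by (intro half_le_sin) auto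
  also have "\<dots> \<le> \<bar>sin (r / 2)\<bar>" by (cases "0 \<le> r") (auto simp: abs_if)
  finally show ?thesis by simp
qed

text \<open>This is ln y \<le> y - 1 at y = \<open>r powr (- 1 / 2)\<close>. The exponent is chosen
  so that the bound is integrable at 0.\<close>

lemma minus_ln_le_powr:
  fixes r :: real assumes "0 < r" shows "- ln r \<le> 2 * r powr (- 1 / 2)"
proof -
  have "ln (r powr (- 1 / 2)) \<le> r powr (- 1 / 2) - 1"
    using assms by (intro ln_le_minus_one) auto
  then show ?thesis using assms by (simp add: ln_powr)
qed

lemma minus_ln_norm_cis_diff_le:
  assumes "s \<noteq> t" "\<bar>s - t\<bar> \<le> pi"
  shows "cis s \<noteq> cis t" "- ln (norm (cis s - cis t)) \<le> 2 * (2 * \<bar>s - t\<bar> powr (- 1 / 2))"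
proof -
  define r where "r = \<bar>s - t\<bar> / 2"
  have r: "0 < r" "\<bar>s - t\<bar> = 2 * r" using assms by (auto simp: r_def)
  have le: "r \<le> norm (cis s - cis t)"
    using abs_le_abs_sin_half[OF assms(2)] by (simp add: norm_cis_diff r_def)
  then show "cis s \<noteq> cis t" using r(1) by auto
  have "- ln (norm (cis s - cis t)) \<le> - ln r"
    unfolding neg_le_iff_le by (subst ln_le_cancel_iff) (use le r(1) in linarith)+
  also have "\<dots> \<le> 2 * r powr (- 1 / 2)" using r(1) by (rule minus_ln_le_powr)
  \<comment> \<open>Passing from half the angular distance back to the full one costs a factor sqrt
    2, rounded up to the inner 2 of the bound; the outer 2 comes from
    \<open>minus_ln_le_powr\<close>.\<close>
  also have "r powr (- 1 / 2) = 2 powr (1 / 2) * (2 * r) powr (- 1 / 2)"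
    using r(1) by (simp add: powr_mult powr_minus)
  also have "2 * (2 powr (1 / 2) * (2 * r) powr (- 1 / 2)) \<le> 2 * (2 * (2 * r) powr (- 1 / 2))"
    using powr_mono[of "1/2" 1 "2::real"] by (intro mult_left_mono mult_right_mono) auto
  finally show "- ln (norm (cis s - cis t)) \<le> 2 * (2 * \<bar>s - t\<bar> powr (- 1 / 2))" by (simp add: r(2))
qed

lemma log_kernel_measurable [measurable (raw)]:
  assumes [measurable]: "f \<in> borel_measurable M" "g \<in> borel_measurable M"
  shows "(\<lambda>x. log_kernel (f x) (g x)) \<in> borel_measurable M"
  unfolding log_kernel_def by measurable

text \<open>A chord is at most the diameter 2. This keeps the negative part in
  \<open>log_energy\<close> finite.\<close>

lemma log_kernel_ge:
  assumes "x \<in> unit_circle" "y \<in> unit_circle" shows "- log_kernel x y \<le> ereal (ln 2)"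
proof (cases "x = y")
  case False
  have "norm (x - y) \<le> 2" using norm_triangle_ineq4[of x y] assms by simp
  then have "ln (norm (x - y)) \<le> ln 2" using False by (subst ln_le_cancel_iff) auto
  then show ?thesis using False by (simp add: log_kernel_def)
qed (simp add: log_kernel_def)

lemma borel_measurable_circle_borelD:
  assumes "Z \<in> measurable M circle_borel"
  shows "Z \<in> borel_measurable M" "\<And>x. x \<in> space M \<Longrightarrow> Z x \<in> unit_circle"
  using assms measurable_space[OF assms] by (auto simp: circle_borel_def measurable_restrict_space2_iff)

text \<open>The negative part is at most ln 2, so finite energy means a finite positive part, and
  the kernel is finite almost everywhere. Hence almost no pair meets the diagonal, the only place
  where \<open>log_kernel\<close> and the real expression \<open>f\<close> disagree, and the
  difference of extended integrals is an ordinary integral.\<close>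

lemma log_energy_distr:
  fixes Z :: "'a \<Rightarrow> complex"
  assumes M: "prob_space M" and Z [measurable]: "Z \<in> measurable M circle_borel"
    and fin: "log_energy (distr M circle_borel Z) \<noteq> \<infinity>"
  defines "f \<equiv> \<lambda>p. - ln (norm (Z (fst p) - Z (snd p)))"
  shows "integrable (M \<Otimes>\<^sub>M M) f" "AE p in M \<Otimes>\<^sub>M M. Z (fst p) \<noteq> Z (snd p)"
    "log_energy (distr M circle_borel Z) = ereal (integral\<^sup>L (M \<Otimes>\<^sub>M M) f)"
proof -
  interpret prob_space M by fact
  interpret P: pair_prob_space M M ..
  have Zb [measurable]: "Z \<in> borel_measurable M" by (rule borel_measurable_circle_borelD) fact
  let ?k = "\<lambda>p. log_kernel (Z (fst p)) (Z (snd p))"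
  have nested: "(\<integral>\<^sup>+x. \<integral>\<^sup>+y. h (log_kernel x y) \<partial>distr M circle_borel Z \<partial>distr M circle_borel Z) =
      (\<integral>\<^sup>+p. h (?k p) \<partial>(M \<Otimes>\<^sub>M M))" if [measurable]: "h \<in> borel_measurable borel" for h :: "ereal \<Rightarrow> ennreal"
  proof -
    have [measurable]: "(\<lambda>p. h (log_kernel (fst p) (snd p))) \<in> borel_measurable (circle_borel \<Otimes>\<^sub>M circle_borel)"
    proof -
      have "(\<lambda>z. z) \<in> borel_measurable circle_borel" by (rule measurable_circle_borelI) simp
      then have [measurable]: "fst \<in> borel_measurable (circle_borel \<Otimes>\<^sub>M circle_borel)" "snd \<in> borel_measurable (circle_borel \<Otimes>\<^sub>M circle_borel)"
        using measurable_compose[OF measurable_fst] measurable_compose[OF measurable_snd] by blast+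
      show ?thesis by measurable
    qed
    interpret D: prob_space "distr M circle_borel Z" by (rule prob_space_distr) fact
    have "(\<integral>\<^sup>+x. \<integral>\<^sup>+y. h (log_kernel x y) \<partial>distr M circle_borel Z \<partial>distr M circle_borel Z) =
      (\<integral>\<^sup>+p. h (log_kernel (fst p) (snd p)) \<partial>(distr M circle_borel Z \<Otimes>\<^sub>M distr M circle_borel Z))"
      by (subst D.nn_integral_fst[symmetric]) auto
    also have "distr M circle_borel Z \<Otimes>\<^sub>M distr M circle_borel Z = distr (M \<Otimes>\<^sub>M M) (circle_borel \<Otimes>\<^sub>M circle_borel) (\<lambda>(x, y). (Z x, Z y))"
      by (rule pair_measure_distr[OF Z Z]) (rule D.sigma_finite_measure_axioms)
    finally show ?thesis by (subst (asm) nn_integral_distr) (auto simp: split_beta')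
  qed
  let ?pos = "\<integral>\<^sup>+p. e2ennreal (?k p) \<partial>(M \<Otimes>\<^sub>M M)" and ?neg = "\<integral>\<^sup>+p. e2ennreal (- ?k p) \<partial>(M \<Otimes>\<^sub>M M)"
  have le: "log_energy (distr M circle_borel Z) = enn2ereal ?pos - enn2ereal ?neg"
    unfolding log_energy_def by (subst (1 2) nested) auto
  have "?neg \<le> (\<integral>\<^sup>+p. ennreal (ln 2) \<partial>(M \<Otimes>\<^sub>M M))"
  proof (rule nn_integral_mono)
    fix p assume "p \<in> space (M \<Otimes>\<^sub>M M)"
    then have "Z (fst p) \<in> unit_circle" "Z (snd p) \<in> unit_circle"
      using borel_measurable_circle_borelD(2)[OF Z] by (auto simp: space_pair_measure)
    from e2ennreal_mono[OF log_kernel_ge[OF this]] show "e2ennreal (- ?k p) \<le> ennreal (ln 2)" by simp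
  qed
  also have "\<dots> = ennreal (ln 2)" by (simp add: P.emeasure_space_1)
  finally have neg: "?neg < \<infinity>" by (rule le_less_trans) simp
  then obtain n where n: "?neg = ennreal n" "0 \<le> n" by (cases ?neg rule: ennreal_cases) auto
  have pos: "?pos \<noteq> \<infinity>" using fin n unfolding le by auto
  then obtain q where q: "?pos = ennreal q" "0 \<le> q" by (cases ?pos rule: ennreal_cases) auto
  have "AE p in M \<Otimes>\<^sub>M M. e2ennreal (?k p) \<noteq> \<infinity>" by (rule nn_integral_PInf_AE) (use pos in auto)
  then show ae: "AE p in M \<Otimes>\<^sub>M M. Z (fst p) \<noteq> Z (snd p)"
    by eventually_elim (auto simp: log_kernel_def)
  have [measurable]: "f \<in> borel_measurable (M \<Otimes>\<^sub>M M)" unfolding f_def by measurable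
  have p': "(\<integral>\<^sup>+p. ennreal (f p) \<partial>(M \<Otimes>\<^sub>M M)) = ?pos"
    by (rule nn_integral_cong_AE) (use ae in eventually_elim, simp add: log_kernel_def f_def)
  have n': "(\<integral>\<^sup>+p. ennreal (- f p) \<partial>(M \<Otimes>\<^sub>M M)) = ?neg"
    by (rule nn_integral_cong_AE) (use ae in eventually_elim, simp add: log_kernel_def f_def)
  show int: "integrable (M \<Otimes>\<^sub>M M) f" using p' n' pos neg by (simp add: real_integrable_def)
  show "log_energy (distr M circle_borel Z) = ereal (integral\<^sup>L (M \<Otimes>\<^sub>M M) f)"
    unfolding le real_lebesgue_integral_def[OF int] p' n' by (simp add: q n)
qed

text \<open>The inner integral is bounded uniformly in its base point: in the window centred there
  the kernel is dominated by an integrable power of the angular distance, and the density by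
  \<open>C\<close>.\<close>

lemma log_energy_bounded_density:
  fixes m :: "complex \<Rightarrow> real"
  assumes [measurable]: "m \<in> borel_measurable circle_borel" and nn: "\<And>z. z \<in> unit_circle \<Longrightarrow> 0 \<le> m z"
    and le: "\<And>z. z \<in> unit_circle \<Longrightarrow> m z \<le> C"
    and mu: "\<mu> = density circle_haar (\<lambda>z. ennreal (m z))" and prob: "circle_prob \<mu>"
  shows "log_energy \<mu> \<noteq> \<infinity>"
proof -
  have sets: "sets \<mu> = sets circle_borel" using prob by (simp add: circle_prob_def)
  interpret prob_space \<mu> using prob by (simp add: circle_prob_def)
  define K where "K = (\<integral>\<^sup>+r. ennreal (2 * r powr (- 1 / 2)) * indicator {0..pi} r \<partial>lborel)"
  have "C \<ge> 0" using nn[of 1] le[of 1] by simp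
  have "K = ennreal (2 * (pi powr (1 / 2) / (1 / 2)))"
  proof -
    have "((\<lambda>r. 2 * r powr (- 1 / 2)) has_integral (2 * (pi powr (1 / 2) / (1 / 2)))) {0..pi}"
      using has_integral_mult_right[OF has_integral_powr_from_0[of "-1/2" pi], of 2] by simp
    then have "((\<lambda>r. 2 * r powr (- 1 / 2) * indicator {0..pi} r) has_integral (2 * (pi powr (1 / 2) / (1 / 2)))) UNIV"
      by (subst (asm) has_integral_restrict_UNIV[symmetric]) (auto elim!: has_integral_eq[rotated] simp: indicator_def)
    from nn_integral_has_integral_lborel[OF _ _ this]
    have "(\<integral>\<^sup>+r. ennreal (2 * r powr (- 1 / 2) * indicator {0..pi} r) \<partial>lborel) = ennreal (2 * (pi powr (1 / 2) / (1 / 2)))"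
      by simp
    also have "(\<integral>\<^sup>+r. ennreal (2 * r powr (- 1 / 2) * indicator {0..pi} r) \<partial>lborel) = K"
      unfolding K_def by (intro nn_integral_cong) (auto simp: indicator_def)
    finally show ?thesis .
  qed
  then have K: "K < \<infinity>" by simp
  have inner: "(\<integral>\<^sup>+y. e2ennreal (log_kernel x y) \<partial>\<mu>) \<le> ennreal (C * 2) * (K + K)" if x: "x \<in> unit_circle" for x
  proof -
    obtain s where s: "x = cis s" using cis_Arg2pi[OF x] by metis
    have [measurable]: "(\<lambda>y. e2ennreal (log_kernel x y)) \<in> borel_measurable circle_borel"
      by (rule measurable_circle_borelI) measurable
    let ?D = "density lborel (\<lambda>t. ennreal (m (cis t) / (2 * pi) * indicator {s - pi..<s - pi + 2 * pi} t))"
    define h where "h r = ennreal (2 * r powr (- 1 / 2)) * indicator {0..pi} r" for r :: real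
    have [measurable]: "h \<in> borel_measurable borel" unfolding h_def by measurable
    have "\<mu> = distr ?D circle_borel cis"
      unfolding mu by (rule density_circle_haar_eq_distr[OF assms(1,2)])
    then have "(\<integral>\<^sup>+y. e2ennreal (log_kernel x y) \<partial>\<mu>) = (\<integral>\<^sup>+t. e2ennreal (log_kernel x (cis t)) \<partial>?D)"
      by (simp add: nn_integral_distr)
    also have "\<dots> = (\<integral>\<^sup>+t. ennreal (m (cis t) / (2 * pi) * indicator {s - pi..<s - pi + 2 * pi} t) * e2ennreal (log_kernel x (cis t)) \<partial>lborel)"
      by (subst nn_integral_density) auto
    \<comment> \<open>There is one copy of \<open>h\<close> for each side of \<open>s\<close>. In
      \<open>C * 2\<close> the first factor absorbs the density together with 1/(2 pi), and the 2 is
      the outer factor in \<open>minus_ln_norm_cis_diff_le\<close>. The point t = s, where the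
      kernel is infinite, is a null set.\<close>
    also have "\<dots> \<le> (\<integral>\<^sup>+t. ennreal (C * 2) * (h (t - s) + h (s - t)) \<partial>lborel)"
    proof (rule nn_integral_mono_AE)
      show "AE t in lborel. ennreal (m (cis t) / (2 * pi) * indicator {s - pi..<s - pi + 2 * pi} t) * e2ennreal (log_kernel x (cis t))
         \<le> ennreal (C * 2) * (h (t - s) + h (s - t))"
        using AE_lborel_singleton[of s]
      proof eventually_elim
        case (elim t)
        show ?case
        proof (cases "t \<in> {s - pi..<s - pi + 2 * pi}")
          case True
          then have t: "\<bar>s - t\<bar> \<le> pi" by auto
          have pos: "cis s \<noteq> cis t"
            and 1: "- ln (norm (cis s - cis t)) \<le> 2 * (2 * \<bar>s - t\<bar> powr (- 1 / 2))"
            using minus_ln_norm_cis_diff_le[of s t] t elim by auto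
          have "e2ennreal (log_kernel x (cis t)) \<le> ennreal (2 * (2 * \<bar>s - t\<bar> powr (- 1 / 2)))"
            using pos ennreal_leI[OF 1] by (simp add: log_kernel_def s)
          also have "\<dots> = ennreal 2 * ennreal (2 * \<bar>s - t\<bar> powr (- 1 / 2))" by (rule ennreal_mult) auto
          also have "ennreal (2 * \<bar>s - t\<bar> powr (- 1 / 2)) \<le> h (t - s) + h (s - t)"
            using t by (cases "s \<le> t") (auto simp: h_def indicator_def)
          finally have 2: "e2ennreal (log_kernel x (cis t)) \<le> ennreal 2 * (h (t - s) + h (s - t))"
            by (simp add: mult_left_mono)
          have "m (cis t) \<le> C" by (rule le) simp
          moreover have "C \<le> C * (2 * pi)" using \<open>C \<ge> 0\<close> pi_gt3 by (intro mult_le_cancel_left1[THEN iffD2]) auto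
          ultimately have "m (cis t) / (2 * pi) \<le> C"
            by (simp add: pos_divide_le_eq)
          then have "ennreal (m (cis t) / (2 * pi)) * e2ennreal (log_kernel x (cis t)) \<le> ennreal C * (ennreal 2 * (h (t - s) + h (s - t)))"
            using 2 by (intro mult_mono ennreal_leI) auto
          then show ?thesis using True \<open>C \<ge> 0\<close> by (simp add: ennreal_mult mult.assoc)
        qed simp
      qed
    qed
    also have "\<dots> = ennreal (C * 2) * ((\<integral>\<^sup>+t. h (t - s) \<partial>lborel) + (\<integral>\<^sup>+t. h (s - t) \<partial>lborel))"
      by (simp add: nn_integral_cmult nn_integral_add)
    also have "(\<integral>\<^sup>+t. h (t - s) \<partial>lborel) = K"
      unfolding K_def h_def[symmetric] by (subst nn_integral_real_affine[of h 1 "- s"]) auto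
    also have "(\<integral>\<^sup>+t. h (s - t) \<partial>lborel) = K"
      unfolding K_def h_def[symmetric] by (subst nn_integral_real_affine[of h "-1" s]) auto
    finally show ?thesis .
  qed
  have "(\<integral>\<^sup>+x. \<integral>\<^sup>+y. e2ennreal (log_kernel x y) \<partial>\<mu> \<partial>\<mu>) \<le> (\<integral>\<^sup>+x. ennreal (C * 2) * (K + K) \<partial>\<mu>)"
    using sets_eq_imp_space_eq[OF sets] by (intro nn_integral_mono inner) auto
  also have "\<dots> = ennreal (C * 2) * (K + K)" by (simp add: emeasure_space_1)
  also have "\<dots> < \<infinity>" using K by (simp add: ennreal_mult_less_top)
  finally have "(\<integral>\<^sup>+x. \<integral>\<^sup>+y. e2ennreal (log_kernel x y) \<partial>\<mu> \<partial>\<mu>) < \<infinity>" .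
  then obtain r where "(\<integral>\<^sup>+x. \<integral>\<^sup>+y. e2ennreal (log_kernel x y) \<partial>\<mu> \<partial>\<mu>) = ennreal r" "0 \<le> r"
    by (cases "\<integral>\<^sup>+x. \<integral>\<^sup>+y. e2ennreal (log_kernel x y) \<partial>\<mu> \<partial>\<mu>" rule: ennreal_cases) auto
  then show ?thesis
    unfolding log_energy_def
    by (cases "enn2ereal (\<integral>\<^sup>+x. \<integral>\<^sup>+y. e2ennreal (- log_kernel x y) \<partial>\<mu> \<partial>\<mu>)") (auto)
qed

section \<open>The Hilbert transform of a Lipschitz density\<close>

lemma circle_differentiable_DERIV:
  assumes "circle_differentiable \<phi>"
  shows "((\<lambda>t. \<phi> (cis t)) has_real_derivative circle_deriv \<phi> (cis x)) (at x)"
proof -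
  have "(\<lambda>t::real. \<phi> (cis x * cis t)) field_differentiable at 0"
    using assms by (simp add: circle_differentiable_def)
  then have "((\<lambda>t::real. \<phi> (cis x * cis t)) has_real_derivative circle_deriv \<phi> (cis x)) (at 0)"
    unfolding circle_deriv_def by (simp add: field_differentiable_derivI)
  then have "((\<lambda>t::real. \<phi> (cis (x + t))) has_real_derivative circle_deriv \<phi> (cis x)) (at 0)"
    by (simp add: cis_mult)
  then show ?thesis using DERIV_at_within_shift[of "\<lambda>t. \<phi> (cis t)" _ x 0 UNIV] by simp
qed

lemma continuous_on_circle_bounded:
  fixes \<phi> :: "complex \<Rightarrow> real"
  assumes "continuous_on unit_circle \<phi>"
  shows "\<exists>C. \<forall>z\<in>unit_circle. \<bar>\<phi> z\<bar> \<le> C"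
proof -
  have "bounded (\<phi> ` unit_circle)"
    by (intro compact_imp_bounded compact_continuous_image assms compact_sphere)
  then show ?thesis by (auto simp: bounded_iff)
qed

text \<open>The mean value inequality is applied to the function of the angle, with a bound for its
  continuous derivative. The distance is angular and \<open>s\<close>, \<open>t\<close> range over
  the whole line, so the estimate serves in every window.\<close>

lemma circle_C1_Lipschitz:
  assumes "circle_C 1 \<phi>"
  obtains L where "0 \<le> L" "\<And>s t. \<bar>\<phi> (cis s) - \<phi> (cis t)\<bar> \<le> L * \<bar>s - t\<bar>"
proof -
  have d: "circle_differentiable \<phi>" and c: "continuous_on unit_circle (circle_deriv \<phi>)"
    using assms by auto
  obtain C where C: "\<And>z. z \<in> unit_circle \<Longrightarrow> \<bar>circle_deriv \<phi> z\<bar> \<le> C"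
    using continuous_on_circle_bounded[OF c] by blast
  have "\<bar>\<phi> (cis s) - \<phi> (cis t)\<bar> \<le> C * \<bar>s - t\<bar>" for s t
    using field_differentiable_bound[of UNIV "\<lambda>t. \<phi> (cis t)" "\<lambda>t. circle_deriv \<phi> (cis t)" C s t]
      circle_differentiable_DERIV[OF d] C by auto
  moreover have "0 \<le> C" using C[of 1] by simp
  ultimately show ?thesis using that by blast
qed

text \<open>Cutting off by the size of the sine, that is by the chord, makes the kernel odd and 2
  pi-periodic on the whole line; on [- pi, pi] it agrees with the cut-off |r| \<ge> \<epsilon>. It
  can thus be evaluated at differences of lifted angles, which range over more than one
  period.\<close>

definition cot_trunc :: "real \<Rightarrow> real \<Rightarrow> real" where
  "cot_trunc \<epsilon> r = (if sin (\<epsilon> / 2) \<le> \<bar>sin (r / 2)\<bar> then cot (r / 2) else 0)"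

lemma cot_trunc_measurable [measurable]: "cot_trunc \<epsilon> \<in> borel_measurable borel"
  unfolding cot_trunc_def cot_def by measurable

lemma cot_trunc_minus [simp]: "cot_trunc \<epsilon> (- r) = - cot_trunc \<epsilon> r"
  by (simp add: cot_trunc_def cot_def)

text \<open>Halving turns a multiple of 2 pi into a multiple of pi, which changes sine and cosine by
  the same sign. Neither their quotient nor the absolute value of the sine is affected.\<close>

lemma cot_trunc_period:
  assumes "cis r = cis r'" shows "cot_trunc \<epsilon> r = cot_trunc \<epsilon> r'"
proof -
  have "sin r = sin r' \<and> cos r = cos r'" using assms by (simp add: complex_eq_iff)
  then obtain n where n: "r = r' + 2 * pi * of_int n" using sin_cos_eq_iff[of r r'] by auto
  have "r / 2 = r' / 2 + pi * of_int n" by (simp add: n add_divide_distrib)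
  then have "sin (r / 2) = (if even n then 1 else - 1) * sin (r' / 2)"
    "cos (r / 2) = (if even n then 1 else - 1) * cos (r' / 2)"
    unfolding \<open>r / 2 = _\<close> by (simp_all add: sin_add cos_add cos_npi_int)
  then have "\<bar>sin (r / 2)\<bar> = \<bar>sin (r' / 2)\<bar>" "cot (r / 2) = cot (r' / 2)"
    by (simp_all add: abs_mult cot_def)
  then show ?thesis by (simp add: cot_trunc_def)
qed

lemma cot_trunc_bound:
  assumes "0 < \<epsilon>" "\<epsilon> \<le> pi" shows "\<bar>cot_trunc \<epsilon> r\<bar> \<le> 1 / sin (\<epsilon> / 2)"
proof -
  have pos: "0 < sin (\<epsilon> / 2)" using assms by (intro sin_gt_zero) auto
  have "\<bar>cos (r / 2)\<bar> / \<bar>sin (r / 2)\<bar> \<le> 1 / sin (\<epsilon> / 2)" if "sin (\<epsilon> / 2) \<le> \<bar>sin (r / 2)\<bar>"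
    using that pos by (intro frac_le) auto
  then show ?thesis using pos by (auto simp: cot_trunc_def cot_def)
qed

lemma cot_trunc_eq:
  assumes "0 < \<epsilon>" "\<epsilon> \<le> pi" "\<bar>r\<bar> \<le> pi"
  shows "cot_trunc \<epsilon> r = (if \<epsilon> \<le> \<bar>r\<bar> then cot (r / 2) else 0)"
proof -
  have "\<bar>sin (r / 2)\<bar> = sin (\<bar>r\<bar> / 2)"
    using assms sin_ge_zero[of "\<bar>r\<bar> / 2"] by (cases "0 \<le> r") auto
  moreover have "sin (\<epsilon> / 2) \<le> sin (\<bar>r\<bar> / 2) \<longleftrightarrow> \<epsilon> \<le> \<bar>r\<bar>"
    using assms by (subst sin_mono_le_eq) auto
  ultimately show ?thesis by (simp add: cot_trunc_def)
qed

lemma abs_cot_half_le: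
  assumes "\<bar>r\<bar> \<le> pi" "r \<noteq> 0" shows "\<bar>cot (r / 2)\<bar> \<le> 4 / \<bar>r\<bar>"
proof -
  have "\<bar>cos (r / 2)\<bar> / \<bar>sin (r / 2)\<bar> \<le> 1 / (\<bar>r\<bar> / 4)"
    using abs_le_abs_sin_half[OF assms(1)] assms(2) by (intro frac_le) auto
  then show ?thesis by (simp add: cot_def)
qed

text \<open>Subtracting \<open>m z\<close> makes the integrand bounded; since the cotangent is odd, this does not
  change the principal value.\<close>

definition hilbert_integrand :: "(complex \<Rightarrow> real) \<Rightarrow> complex \<Rightarrow> real \<Rightarrow> real" where
  "hilbert_integrand m z r = indicator {- pi..pi} r * ((m (z * cis (- r)) - m z) / (2 * pi))"

definition hilbert_reg :: "(complex \<Rightarrow> real) \<Rightarrow> complex \<Rightarrow> real" where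
  "hilbert_reg m z = (LINT r|lborel. cot (r / 2) * hilbert_integrand m z r)"

definition hilbert_trunc :: "(complex \<Rightarrow> real) \<Rightarrow> real \<Rightarrow> complex \<Rightarrow> real" where
  "hilbert_trunc m \<epsilon> z = (LINT r|lborel. cot_trunc \<epsilon> r * hilbert_integrand m z r)"

lemma rotation_measurable: "(\<lambda>p. fst p * cis (- snd p)) \<in> measurable (circle_borel \<Otimes>\<^sub>M borel) circle_borel"
proof -
  have "(\<lambda>z. z) \<in> borel_measurable circle_borel" by (rule measurable_circle_borelI) simp
  then have [measurable]: "fst \<in> borel_measurable (circle_borel \<Otimes>\<^sub>M borel)"
    using measurable_compose[OF measurable_fst] by blast
  have "(\<lambda>p. fst p * cis (- snd p)) \<in> borel_measurable (circle_borel \<Otimes>\<^sub>M borel)" by measurable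
  then show ?thesis
    unfolding circle_borel_def measurable_restrict_space2_iff
    by (auto simp: circle_borel_def[symmetric] space_pair_measure norm_mult)
qed

lemma hilbert_reg_measurable:
  assumes [measurable]: "m \<in> borel_measurable circle_borel"
  shows "hilbert_reg m \<in> borel_measurable circle_borel"
proof -
  note rotation_measurable [measurable]
  have [measurable]: "(\<lambda>p. m (fst p * cis (- snd p))) \<in> borel_measurable (circle_borel \<Otimes>\<^sub>M borel)"
    using measurable_compose[OF rotation_measurable assms] .
  show ?thesis
    unfolding hilbert_reg_def[abs_def] hilbert_integrand_def cot_def
    by (rule lborel.borel_measurable_lebesgue_integral) (simp add: split_beta')
qed

lemma hilbert_trunc_measurable:
  assumes [measurable]: "m \<in> borel_measurable circle_borel"
  shows "hilbert_trunc m \<epsilon> \<in> borel_measurable circle_borel"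
proof -
  note rotation_measurable [measurable]
  have [measurable]: "(\<lambda>p. m (fst p * cis (- snd p))) \<in> borel_measurable (circle_borel \<Otimes>\<^sub>M borel)"
    using measurable_compose[OF rotation_measurable assms] .
  show ?thesis
    unfolding hilbert_trunc_def[abs_def] hilbert_integrand_def
    by (rule lborel.borel_measurable_lebesgue_integral) (simp add: split_beta')
qed

context
  fixes m :: "complex \<Rightarrow> real" and L :: real
  assumes m_meas [measurable]: "m \<in> borel_measurable circle_borel"
    and Lip: "\<And>s t. \<bar>m (cis s) - m (cis t)\<bar> \<le> L * \<bar>s - t\<bar>" and L: "0 \<le> L"
begin

lemma hilbert_integrand_measurable:
  assumes "z \<in> unit_circle" shows "hilbert_integrand m z \<in> borel_measurable borel"
proof -
  have "z = cis (Arg2pi z)" using assms by (simp add: cis_Arg2pi)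
  then have "z * cis (- r) = cis (Arg2pi z - r)" for r by (metis cis_mult diff_conv_add_uminus)
  then show ?thesis unfolding hilbert_integrand_def[abs_def] by simp
qed

lemma abs_hilbert_integrand_le:
  assumes "z \<in> unit_circle" shows "\<bar>hilbert_integrand m z r\<bar> \<le> L * \<bar>r\<bar> * indicator {- pi..pi} r"
proof -
  have z: "z = cis (Arg2pi z)" using assms by (simp add: cis_Arg2pi)
  then have "z * cis (- r) = cis (Arg2pi z - r)" by (metis cis_mult diff_conv_add_uminus)
  then have "\<bar>m (z * cis (- r)) - m z\<bar> \<le> L * \<bar>r\<bar>" using Lip[of "Arg2pi z - r" "Arg2pi z"] z by simp
  moreover have "L * \<bar>r\<bar> * 1 \<le> L * \<bar>r\<bar> * (2 * pi)" using L pi_gt3 by (intro mult_left_mono) auto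
  ultimately have "\<bar>m (z * cis (- r)) - m z\<bar> / (2 * pi) \<le> L * \<bar>r\<bar>" by (simp add: pos_divide_le_eq)
  then show ?thesis by (simp add: hilbert_integrand_def indicator_def)
qed

text \<open>The bound 4 / |r| for the cotangent cancels against the Lipschitz bound L |r|, so
  \<open>hilbert_reg\<close> is an absolutely convergent integral and no principal value is
  left.\<close>

lemma abs_cot_hilbert_integrand_le:
  assumes "z \<in> unit_circle" shows "\<bar>cot (r / 2) * hilbert_integrand m z r\<bar> \<le> 4 * L * indicator {- pi..pi} r"
proof (cases "r \<in> {- pi..pi} \<and> r \<noteq> 0")
  case True
  then have "\<bar>cot (r / 2)\<bar> * \<bar>hilbert_integrand m z r\<bar> \<le> (4 / \<bar>r\<bar>) * (L * \<bar>r\<bar> * 1)"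
    using abs_cot_half_le[of r] abs_hilbert_integrand_le[OF assms, of r] by (intro mult_mono) auto
  then show ?thesis using True by (simp add: abs_mult)
next
  case False
  then have "hilbert_integrand m z r = 0" using assms by (auto simp: hilbert_integrand_def)
  then show ?thesis using L by simp
qed

lemma integrable_const_arc: "integrable lborel (\<lambda>r::real. c * indicator {- e..e} r :: real)"
  by (intro integrable_mult_right) (auto intro!: integrable_real_indicator simp: emeasure_bounded_finite[unfolded infinity_ennreal_def])

lemma integrable_cot_hilbert:
  assumes "z \<in> unit_circle" shows "integrable lborel (\<lambda>r. cot (r / 2) * hilbert_integrand m z r)"
proof (rule Bochner_Integration.integrable_bound[OF integrable_const_arc[of "4 * L" pi]])
  note hilbert_integrand_measurable[OF assms, measurable]
  show "(\<lambda>r. cot (r / 2) * hilbert_integrand m z r) \<in> borel_measurable lborel"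
    unfolding cot_def by measurable
  show "AE r in lborel. norm (cot (r / 2) * hilbert_integrand m z r) \<le> norm (4 * L * indicat_real {- pi..pi} r)"
    using abs_cot_hilbert_integrand_le[OF assms] L by (intro AE_I2) simp
qed

lemma integrable_cot_trunc_hilbert:
  assumes "z \<in> unit_circle" shows "integrable lborel (\<lambda>r. cot_trunc \<epsilon> r * hilbert_integrand m z r)"
proof (rule Bochner_Integration.integrable_bound[OF integrable_const_arc[of "4 * L" pi]])
  note hilbert_integrand_measurable[OF assms, measurable]
  show "(\<lambda>r. cot_trunc \<epsilon> r * hilbert_integrand m z r) \<in> borel_measurable lborel"
    by measurable
  show "AE r in lborel. norm (cot_trunc \<epsilon> r * hilbert_integrand m z r) \<le> norm (4 * L * indicat_real {- pi..pi} r)"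
    using abs_cot_hilbert_integrand_le[OF assms] L by (intro AE_I2) (simp add: cot_trunc_def)
qed

lemma abs_hilbert_reg_le:
  assumes "z \<in> unit_circle" shows "\<bar>hilbert_reg m z\<bar> \<le> 8 * pi * L"
proof -
  have "\<bar>hilbert_reg m z\<bar> \<le> (LINT r|lborel. 4 * L * indicator {- pi..pi} r)"
    unfolding hilbert_reg_def using abs_cot_hilbert_integrand_le[OF assms]
    by (intro integral_abs_bound[THEN order_trans] integral_mono integrable_abs integrable_cot_hilbert[OF assms] integrable_const_arc)
  then show ?thesis by (simp add: mult_ac)
qed

text \<open>The integrands agree outside [- \<epsilon>, \<epsilon>] and differ inside by at most 4
  L, over a length of 2 \<epsilon>. The rate does not depend on \<open>z\<close>.\<close>

lemma abs_hilbert_trunc_diff_le: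
  assumes "z \<in> unit_circle" "0 < \<epsilon>" "\<epsilon> \<le> pi"
  shows "\<bar>hilbert_trunc m \<epsilon> z - hilbert_reg m z\<bar> \<le> 8 * L * \<epsilon>"
proof -
  have "\<bar>hilbert_trunc m \<epsilon> z - hilbert_reg m z\<bar> =
     \<bar>LINT r|lborel. cot_trunc \<epsilon> r * hilbert_integrand m z r - cot (r / 2) * hilbert_integrand m z r\<bar>"
    unfolding hilbert_trunc_def hilbert_reg_def
    by (subst Bochner_Integration.integral_diff) (auto intro: integrable_cot_hilbert integrable_cot_trunc_hilbert assms)
  also have "\<dots> \<le> (LINT r|lborel. 4 * L * indicator {- \<epsilon>..\<epsilon>} r)"
  proof (intro integral_abs_bound[THEN order_trans] integral_mono integrable_abs
      integrable_const_arc Bochner_Integration.integrable_diff integrable_cot_hilbert integrable_cot_trunc_hilbert assms)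
    fix r
    have "cot_trunc \<epsilon> r * hilbert_integrand m z r = cot (r / 2) * hilbert_integrand m z r" if "r \<notin> {- \<epsilon>..\<epsilon>}"
    proof (cases "r \<in> {- pi..pi}")
      case True
      then have "\<bar>r\<bar> \<le> pi" "\<epsilon> \<le> \<bar>r\<bar>" using that by auto
      then show ?thesis using cot_trunc_eq[OF assms(2,3), of r] by simp
    qed (simp add: hilbert_integrand_def)
    moreover have "\<bar>cot_trunc \<epsilon> r * hilbert_integrand m z r - cot (r / 2) * hilbert_integrand m z r\<bar> \<le> 4 * L"
      using abs_cot_hilbert_integrand_le[OF assms(1), of r] L
        mult_left_mono[of "indicat_real {- pi..pi} r" 1 "4 * L"]
      by (auto simp: cot_trunc_def indicator_def)
    ultimately show "\<bar>cot_trunc \<epsilon> r * hilbert_integrand m z r - cot (r / 2) * hilbert_integrand m z r\<bar> \<le> 4 * L * indicator {- \<epsilon>..\<epsilon>} r"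
      by (cases "r \<in> {- \<epsilon>..\<epsilon>}") auto
  qed
  also have "\<dots> = 8 * L * \<epsilon>" using assms by (simp add: mult_ac)
  finally show ?thesis .
qed

text \<open>Once the kernel is truncated, the subtracted constant \<open>m (cis x)\<close> can be
  added back: the added integrand is bounded on a symmetric window and odd, so it integrates to
  0.\<close>

lemma hilbert_trunc_eq:
  assumes "0 < \<epsilon>" "\<epsilon> \<le> pi"
  shows "hilbert_trunc m \<epsilon> (cis x) = (LINT r|lborel. indicator {- pi..pi} r * cot_trunc \<epsilon> r * (m (cis (x - r)) / (2 * pi)))"
proof -
  let ?g = "\<lambda>r. indicator {- pi..pi} r * cot_trunc \<epsilon> r * (m (cis x) / (2 * pi))"
  have meas: "?g \<in> borel_measurable lborel" by measurable
  have g: "integrable lborel ?g"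
  proof (rule Bochner_Integration.integrable_bound[OF integrable_const_arc[of "1 / sin (\<epsilon> / 2) * \<bar>m (cis x) / (2 * pi)\<bar>" pi] meas])
    have "\<bar>cot_trunc \<epsilon> r\<bar> * \<bar>m (cis x) / (2 * pi)\<bar> \<le> 1 / sin (\<epsilon> / 2) * \<bar>m (cis x) / (2 * pi)\<bar>" for r
      using cot_trunc_bound[OF assms] by (rule mult_right_mono) simp
    moreover have "0 \<le> 1 / sin (\<epsilon> / 2)" using cot_trunc_bound[OF assms, of 0] by linarith
    ultimately show "AE r in lborel. norm (?g r) \<le> norm (1 / sin (\<epsilon> / 2) * \<bar>m (cis x) / (2 * pi)\<bar> * indicat_real {- pi..pi} r)"
      by (intro AE_I2) (simp add: indicator_def abs_mult)
  qed
  have "(LINT r|lborel. ?g r) = (LINT r|lborel. ?g (- r))"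
    using lborel_integral_real_affine[of "-1" ?g 0] by simp
  also have "(\<lambda>r. ?g (- r)) = (\<lambda>r. - ?g r)"
  proof
    fix r
    have "- r \<in> {- pi..pi} \<longleftrightarrow> r \<in> {- pi..pi}" by auto
    then show "?g (- r) = - ?g r" by (simp add: indicator_def del: atLeastAtMost_iff)
  qed
  also have "(LINT r|lborel. - ?g r) = - (LINT r|lborel. ?g r)" by simp
  finally have "(LINT r|lborel. ?g r) = 0" by linarith
  then have "hilbert_trunc m \<epsilon> (cis x) = (LINT r|lborel. cot_trunc \<epsilon> r * hilbert_integrand m (cis x) r) + (LINT r|lborel. ?g r)"
    by (simp add: hilbert_trunc_def)
  also have "\<dots> = (LINT r|lborel. cot_trunc \<epsilon> r * hilbert_integrand m (cis x) r + ?g r)"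
    by (rule Bochner_Integration.integral_add[symmetric, OF integrable_cot_trunc_hilbert g]) simp
  also have "\<dots> = (LINT r|lborel. indicator {- pi..pi} r * cot_trunc \<epsilon> r * (m (cis (x - r)) / (2 * pi)))"
    by (intro Bochner_Integration.integral_cong)
      (simp_all add: hilbert_integrand_def cis_mult diff_divide_distrib algebra_simps)
  finally show ?thesis .
qed

text \<open>Integration over pairs produces the transform in this form. \<open>Arg2pi z\<close>
  merely stands for some angle of \<open>z\<close>; periodicity of \<open>cot_trunc\<close> replaces
  it by the angle in the window centred at \<open>x\<close>.\<close>

lemma integral_cot_trunc:
  assumes "0 < \<epsilon>" "\<epsilon> \<le> pi" and nn: "\<And>z. z \<in> unit_circle \<Longrightarrow> 0 \<le> m z"
  shows "(\<integral>z. cot_trunc \<epsilon> (x - Arg2pi z) \<partial>density circle_haar (\<lambda>z. ennreal (m z))) = hilbert_trunc m \<epsilon> (cis x)"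
proof -
  note borel_measurable_Arg2pi [measurable]
  have [measurable]: "Arg2pi \<in> borel_measurable circle_borel" by (rule measurable_circle_borelI) measurable
  let ?w = "\<lambda>t. m (cis t) / (2 * pi) * indicator {x - pi..<x - pi + 2 * pi} t"
  have "density circle_haar (\<lambda>z. ennreal (m z)) = distr (density lborel (\<lambda>t. ennreal (?w t))) circle_borel cis"
    by (rule density_circle_haar_eq_distr[OF m_meas nn])
  then have "(\<integral>z. cot_trunc \<epsilon> (x - Arg2pi z) \<partial>density circle_haar (\<lambda>z. ennreal (m z))) =
     (\<integral>t. cot_trunc \<epsilon> (x - Arg2pi (cis t)) \<partial>density lborel (\<lambda>t. ennreal (?w t)))"
    by (simp add: integral_distr)
  also have "\<dots> = (LINT t|lborel. ?w t * cot_trunc \<epsilon> (x - Arg2pi (cis t)))"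
    using nn by (subst integral_density) auto
  also have "\<dots> = (LINT t|lborel. ?w t * cot_trunc \<epsilon> (x - t))"
  proof -
    have "cot_trunc \<epsilon> (x - Arg2pi (cis t)) = cot_trunc \<epsilon> (x - t)" for t
      by (rule cot_trunc_period) (simp add: cis_divide[symmetric] cis_Arg2pi)
    then show ?thesis by simp
  qed
  also have "\<dots> = (LINT r|lborel. ?w (x - r) * cot_trunc \<epsilon> r)"
    using lborel_integral_real_affine[of "-1" "\<lambda>t. ?w t * cot_trunc \<epsilon> (x - t)" x] by simp
  also have "\<dots> = (LINT r|lborel. indicator {- pi..pi} r * cot_trunc \<epsilon> r * (m (cis (x - r)) / (2 * pi)))"
  proof (rule integral_cong_AE)
    \<comment> \<open>Reflection turns the half-open window into (- pi, pi], which misses only the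
      endpoint - pi of the closed one.\<close>
    show "AE r in lborel. ?w (x - r) * cot_trunc \<epsilon> r = indicator {- pi..pi} r * cot_trunc \<epsilon> r * (m (cis (x - r)) / (2 * pi))"
      using AE_lborel_singleton[of "- pi"] by eventually_elim (auto simp: indicator_def)
  qed measurable
  finally show ?thesis using hilbert_trunc_eq[OF assms(1,2)] by simp
qed

text \<open>\<open>Lim\<close> is a definite description and says nothing about existence. The
  linear rate in \<epsilon> provides the limit, so the definition really denotes the principal
  value.\<close>

lemma circle_hilbert_eq_hilbert_reg:
  assumes z: "z \<in> unit_circle" and m: "smooth_density \<mu> = m"
  shows "circle_hilbert \<mu> z = hilbert_reg m z"
proof -
  define x where "x = Arg z"
  have "z \<noteq> 0" using z by auto
  then have zx: "z = cis x" using cis_Arg[of z] z by (simp add: x_def sgn_div_norm)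
  have eq: "(LINT y:{x - pi..x - \<epsilon>} \<union> {x + \<epsilon>..x + pi}|lborel. cot ((x - y) / 2) * m (cis y) / (2 * pi)) = hilbert_trunc m \<epsilon> z"
    if e: "0 < \<epsilon>" "\<epsilon> \<le> pi" for \<epsilon>
  proof -
    let ?S = "{x - pi..x - \<epsilon>} \<union> {x + \<epsilon>..x + pi}"
    have "(LINT y:?S|lborel. cot ((x - y) / 2) * m (cis y) / (2 * pi)) =
      (LINT r|lborel. indicator ?S (x - r) * (cot (r / 2) * m (cis (x - r)) / (2 * pi)))"
      unfolding set_lebesgue_integral_def
      using lborel_integral_real_affine[of "-1" "\<lambda>y. indicator ?S y *\<^sub>R (cot ((x - y) / 2) * m (cis y) / (2 * pi))" x] by simp
    also have "\<dots> = (LINT r|lborel. indicator {- pi..pi} r * cot_trunc \<epsilon> r * (m (cis (x - r)) / (2 * pi)))"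
    proof (rule Bochner_Integration.integral_cong)
      fix r
      have "x - r \<in> ?S \<longleftrightarrow> r \<in> {- pi..pi} \<and> \<epsilon> \<le> \<bar>r\<bar>" using e by (auto simp: abs_if split: if_splits)
      then show "indicator ?S (x - r) * (cot (r / 2) * m (cis (x - r)) / (2 * pi)) =
          indicator {- pi..pi} r * cot_trunc \<epsilon> r * (m (cis (x - r)) / (2 * pi))"
        using cot_trunc_eq[OF e, of r] by (cases "r \<in> {- pi..pi}") (auto simp: indicator_def abs_le_iff)
    qed simp
    finally show ?thesis using hilbert_trunc_eq[OF e] by (simp add: zx)
  qed
  have "((\<lambda>\<epsilon>. hilbert_trunc m \<epsilon> z) \<longlongrightarrow> hilbert_reg m z) (at_right 0)"
  proof (rule LIM_zero_cancel, rule Lim_null_comparison)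
    show "\<forall>\<^sub>F \<epsilon> in at_right 0. norm (hilbert_trunc m \<epsilon> z - hilbert_reg m z) \<le> 8 * L * \<epsilon>"
      using eventually_at_right_real[OF pi_gt_zero]
      by eventually_elim (use abs_hilbert_trunc_diff_le[OF z] in auto)
    show "((\<lambda>\<epsilon>. 8 * L * \<epsilon>) \<longlongrightarrow> 0) (at_right 0)"
      by (auto intro!: tendsto_eq_intros)
  qed
  moreover have "\<forall>\<^sub>F \<epsilon> in at_right 0. hilbert_trunc m \<epsilon> z =
      (LINT y:{x - pi..x - \<epsilon>} \<union> {x + \<epsilon>..x + pi}|lborel. cot ((x - y) / 2) * m (cis y) / (2 * pi))"
    using eventually_at_right_real[OF pi_gt_zero] by eventually_elim (use eq in auto)
  ultimately have "((\<lambda>\<epsilon>. LINT y:{x - pi..x - \<epsilon>} \<union> {x + \<epsilon>..x + pi}|lborel. cot ((x - y) / 2) * m (cis y) / (2 * pi)) \<longlongrightarrow> hilbert_reg m z) (at_right 0)"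
    by (rule Lim_transform_eventually)
  then show ?thesis
    unfolding circle_hilbert_def m Let_def x_def[symmetric] by (intro tendsto_Lim) simp_all
qed

end

section \<open>Equal means and convexity\<close>

lemma circle_differentiable_continuous:
  assumes "circle_differentiable \<phi>" shows "continuous_on A (\<lambda>t. \<phi> (cis t))"
  by (intro continuous_at_imp_continuous_on ballI DERIV_isCont[OF circle_differentiable_DERIV[OF assms]])

lemma circle_differentiable_measurable:
  assumes "circle_differentiable \<phi>" shows "\<phi> \<in> borel_measurable circle_borel"
proof -
  have "(\<lambda>t. \<phi> (cis t)) \<in> borel_measurable borel"
    by (intro borel_measurable_continuous_onI circle_differentiable_continuous assms)
  moreover have "Arg2pi \<in> borel_measurable circle_borel"
    by (rule measurable_circle_borelI) (rule borel_measurable_Arg2pi)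
  ultimately have "(\<lambda>z. \<phi> (cis (Arg2pi z))) \<in> borel_measurable circle_borel" by simp
  then show ?thesis
    by (rule measurable_cong[THEN iffD1, rotated]) (simp add: cis_Arg2pi)
qed

lemma circle_differentiable_bounded:
  assumes "circle_differentiable \<phi>" obtains C where "\<And>z. z \<in> unit_circle \<Longrightarrow> \<bar>\<phi> z\<bar> \<le> C"
proof -
  have "compact ((\<lambda>t. \<phi> (cis t)) ` {0..2 * pi})"
    by (intro compact_continuous_image circle_differentiable_continuous assms) simp
  then have "bounded ((\<lambda>t. \<phi> (cis t)) ` {0..2 * pi})" by (rule compact_imp_bounded)
  then obtain C where C: "\<forall>t\<in>{0..2 * pi}. \<bar>\<phi> (cis t)\<bar> \<le> C" by (auto simp: bounded_iff)
  show ?thesis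
  proof (rule that)
    fix z :: complex assume "z \<in> unit_circle"
    then show "\<bar>\<phi> z\<bar> \<le> C"
      using C[rule_format, of "Arg2pi z"] Arg2pi_ge_0[of z] Arg2pi_lt_2pi[of z] by (simp add: cis_Arg2pi)
  qed
qed

lemma density_circle_haar_atomless:
  assumes [measurable]: "m \<in> borel_measurable circle_borel" and nn: "\<And>z. z \<in> unit_circle \<Longrightarrow> 0 \<le> m z"
    and z: "z \<in> unit_circle"
  shows "emeasure (density circle_haar (\<lambda>z. ennreal (m z))) {z} = 0"
proof -
  let ?w = "\<lambda>t. ennreal (m (cis t) / (2 * pi) * indicator {0..<0 + 2 * pi} t)"
  have "{z} = unit_circle \<inter> {z}" using z by auto
  then have [measurable]: "{z} \<in> sets circle_borel"
    unfolding circle_borel_def by (auto simp: sets_restrict_space)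
  have "density circle_haar (\<lambda>z. ennreal (m z)) = distr (density lborel ?w) circle_borel cis"
    by (rule density_circle_haar_eq_distr[OF assms(1,2)])
  then have "emeasure (density circle_haar (\<lambda>z. ennreal (m z))) {z} = emeasure (density lborel ?w) (cis -` {z})"
    by (simp add: emeasure_distr)
  also have "\<dots> = (\<integral>\<^sup>+t. ?w t * indicator (cis -` {z}) t \<partial>lborel)"
    using measurable_sets[OF cis_measurable, of "{z}"] by (subst emeasure_density) auto
  also have "\<dots> = (\<integral>\<^sup>+t. 0 \<partial>(lborel :: real measure))"
  proof (rule nn_integral_cong_AE)
    show "AE t in lborel. ?w t * indicator (cis -` {z}) t = 0"
      using AE_lborel_singleton[of "Arg2pi z"]
    proof eventually_elim
      case (elim t)
      have "cis t \<noteq> z" if "t \<in> {0..<2 * pi}" using Arg2pi_cis[of t] that elim by auto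
      then show ?case by (auto simp: indicator_def)
    qed
  qed
  finally show ?thesis by simp
qed

lemma space_circle_prob: "circle_prob \<mu> \<Longrightarrow> space \<mu> = unit_circle"
  using sets_eq_imp_space_eq[of \<mu> circle_borel] by (simp add: circle_prob_def)

lemma measurable_circle_prob: "circle_prob \<mu> \<Longrightarrow> measurable \<mu> N = measurable circle_borel N"
  by (rule measurable_cong_sets) (simp_all add: circle_prob_def)

lemma arc_lift_eq_Arg2pi:
  assumes "z \<in> unit_circle" "0 \<le> u" "u \<le> 2 * pi"
  shows "arc_lift u z = Arg2pi z + (if Arg2pi z < u then 2 * pi else 0)"
proof -
  let ?x = "Arg2pi z + (if Arg2pi z < u then 2 * pi else 0)"
  have "cis ?x = z" using cis_Arg2pi[OF assms(1)] by (simp flip: cis_mult)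
  moreover have "arc_lift u (cis ?x) = ?x"
    using Arg2pi_ge_0[of z] Arg2pi_lt_2pi[of z] assms by (intro arc_lift_cis) auto
  ultimately show ?thesis by simp
qed

text \<open>Moving the cut from 0 to \<open>u\<close> raises exactly the points with angle below
  \<open>u\<close> by one full turn.\<close>

lemma mean_lift_from:
  assumes "circle_prob \<mu>" "0 \<le> u" "u \<le> 2 * pi"
  shows "(\<integral>x. x \<partial>lift_from \<mu> u) = (\<integral>z. Arg2pi z \<partial>\<mu>) + 2 * pi * measure \<mu> {z \<in> space \<mu>. Arg2pi z < u}"
proof -
  interpret prob_space \<mu> using assms by (simp add: circle_prob_def)
  note borel_measurable_Arg2pi [measurable]
  have [measurable]: "Arg2pi \<in> borel_measurable \<mu>" "arc_lift u \<in> borel_measurable \<mu>"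
    unfolding measurable_circle_prob[OF assms(1)] by (rule measurable_circle_borelI; measurable)+
  have int: "integrable \<mu> Arg2pi"
    using Arg2pi_ge_0 Arg2pi_lt_2pi by (intro integrable_const_bound[where B = "2 * pi"]) (auto intro!: AE_I2 simp: less_imp_le)
  have "(\<integral>x. x \<partial>lift_from \<mu> u) = (\<integral>z. arc_lift u z \<partial>\<mu>)"
    unfolding lift_from_eq_distr[OF assms(1)] by (subst integral_distr) auto
  also have "\<dots> = (\<integral>z. Arg2pi z + 2 * pi * indicator {z \<in> space \<mu>. Arg2pi z < u} z \<partial>\<mu>)"
    using space_circle_prob[OF assms(1)] arc_lift_eq_Arg2pi[OF _ assms(2,3)]
    by (intro Bochner_Integration.integral_cong) (auto simp: indicator_def)
  also have "\<dots> = (\<integral>z. Arg2pi z \<partial>\<mu>) + 2 * pi * measure \<mu> {z \<in> space \<mu>. Arg2pi z < u}"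
    by (subst Bochner_Integration.integral_add) (auto simp: int less_top[symmetric] intro!: integrable_mult_right integrable_real_indicator)
  finally show ?thesis .
qed

text \<open>This makes the supremum in \<open>circle_wasserstein\<close> run over a nonempty set.
  Without atoms in \<mu>, the mean of its lift is continuous in the cut and sweeps an interval of
  length 2 pi. The mean for \<nu> may jump, so only its cuts 0 and 2 pi are tried. They give means 2
  pi apart, and since both means at cut 0 lie in [0, 2 pi], one of the two falls into the swept
  interval; the intermediate value theorem then yields \<open>u\<close>.\<close>

lemma ex_equal_means:
  assumes mu: "circle_prob \<mu>" and nu: "circle_prob \<nu>"
    and atomless: "\<And>z. z \<in> unit_circle \<Longrightarrow> emeasure \<mu> {z} = 0"
  shows "\<exists>u\<in>{0..2 * pi}. \<exists>v\<in>{0..2 * pi}. (\<integral>x. x \<partial>lift_from \<mu> u) = (\<integral>x. x \<partial>lift_from \<nu> v)"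
proof -
  interpret mu: prob_space \<mu> using mu by (simp add: circle_prob_def)
  interpret nu: prob_space \<nu> using nu by (simp add: circle_prob_def)
  note borel_measurable_Arg2pi [measurable]
  have [measurable]: "Arg2pi \<in> borel_measurable \<mu>" "Arg2pi \<in> borel_measurable \<nu>"
    unfolding measurable_circle_prob[OF mu] measurable_circle_prob[OF nu] by (rule measurable_circle_borelI; measurable)+
  let ?A = "distr \<mu> borel Arg2pi"
  interpret A: real_distribution ?A
    by (simp add: real_distribution_def real_distribution_axioms_def mu.prob_space_distr)
  have null: "measure \<mu> {z \<in> space \<mu>. Arg2pi z = u} = 0" for u
  proof -
    have "{z \<in> space \<mu>. Arg2pi z = u} \<subseteq> {cis u}"
      using cis_Arg2pi by (auto simp: space_circle_prob[OF mu])
    moreover have "{cis u} \<in> sets \<mu>"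
    proof -
      have "{cis u} = unit_circle \<inter> {cis u}" by auto
      then show ?thesis using mu unfolding circle_prob_def circle_borel_def by (auto simp: sets_restrict_space)
    qed
    ultimately have "emeasure \<mu> {z \<in> space \<mu>. Arg2pi z = u} \<le> 0"
      using emeasure_mono atomless[of "cis u"] by (metis norm_cis mem_sphere_0)
    then show ?thesis by (simp add: measure_def)
  qed
  have F: "measure \<mu> {z \<in> space \<mu>. Arg2pi z < u} = cdf ?A u" for u
  proof -
    have "cdf ?A u = measure \<mu> ({z \<in> space \<mu>. Arg2pi z < u} \<union> {z \<in> space \<mu>. Arg2pi z = u})"
      unfolding cdf_def by (subst measure_distr) (auto intro!: arg_cong[where f = "measure \<mu>"])
    also have "\<dots> = measure \<mu> {z \<in> space \<mu>. Arg2pi z < u} + measure \<mu> {z \<in> space \<mu>. Arg2pi z = u}"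
      by (rule mu.finite_measure_Union) auto
    finally show ?thesis using null by simp
  qed
  let ?M = "\<integral>z. Arg2pi z \<partial>\<mu>" and ?N = "\<integral>z. Arg2pi z \<partial>\<nu>"
  have cont: "continuous_on {0..2 * pi} (\<lambda>u. ?M + 2 * pi * cdf ?A u)"
  proof (intro continuous_intros continuous_at_imp_continuous_on ballI A.isCont_cdf[THEN iffD2])
    fix x show "measure ?A {x} = 0"
      using null[of x] by (subst measure_distr) (auto simp: vimage_def Int_def conj_commute)
  qed
  have F0: "cdf ?A 0 = 0"
    unfolding F[symmetric] by (simp add: not_less[THEN iffD2, OF Arg2pi_ge_0])
  have F1: "cdf ?A (2 * pi) = 1"
    unfolding F[symmetric] using Arg2pi_lt_2pi by (simp add: mu.prob_space)
  have N0: "(\<integral>x. x \<partial>lift_from \<nu> 0) = ?N"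
    using mean_lift_from[OF nu, of 0] by (simp add: not_less[THEN iffD2, OF Arg2pi_ge_0])
  have N1: "(\<integral>x. x \<partial>lift_from \<nu> (2 * pi)) = ?N + 2 * pi"
    using mean_lift_from[OF nu, of "2 * pi"] Arg2pi_lt_2pi by (simp add: nu.prob_space)
  have intv: "0 \<le> ?M \<and> ?M \<le> 2 * pi" "0 \<le> ?N \<and> ?N \<le> 2 * pi"
    using Arg2pi_ge_0 Arg2pi_lt_2pi
    by (auto intro!: integral_nonneg_AE mu.integral_le_const nu.integral_le_const mu.integrable_const_bound[where B = "2 * pi"]
        nu.integrable_const_bound[where B = "2 * pi"] AE_I2 simp: less_imp_le)
  obtain v where v: "v \<in> {0..2 * pi}" "?M \<le> (\<integral>x. x \<partial>lift_from \<nu> v)" "(\<integral>x. x \<partial>lift_from \<nu> v) \<le> ?M + 2 * pi"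
  proof (cases "?M \<le> ?N")
    case True
    then show ?thesis using that[of 0] intv N0 by auto
  next
    case False
    then show ?thesis using that[of "2 * pi"] intv N1 by auto
  qed
  have "\<exists>u\<ge>0. u \<le> 2 * pi \<and> ?M + 2 * pi * cdf ?A u = (\<integral>x. x \<partial>lift_from \<nu> v)"
    by (rule IVT'[OF _ _ _ cont]) (use v F0 F1 in auto)
  then show ?thesis using v(1) mean_lift_from[OF mu] F by (metis atLeastAtMost_iff)
qed

section \<open>Tangent inequalities with a quadratic remainder\<close>

lemma log_sine_convex:
  assumes "0 < a" "a < 2 * pi" "0 < b" "b < 2 * pi"
  shows "- ln (2 * sin (a / 2)) - cot (a / 2) / 2 * (b - a) + (b - a)\<^sup>2 / 8 \<le> - ln (2 * sin (b / 2))"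
proof -
  let ?C = "{0<..<2 * pi}"
  have pos: "0 < sin (x / 2)" if "x \<in> ?C" for x using that by (intro sin_gt_zero) auto
  \<comment> \<open>The second derivative after subtraction of x^2/8 is (1 / sin^2(x/2) - 1) / 4,
    which is nonnegative. The quadratic terms of the tangent inequality then regroup to (b -
    a)^2/8.\<close>
  have "(- (cot (a / 2) / 2) - a / 4) * (b - a) \<le> (- ln (2 * sin (b / 2)) - b\<^sup>2 / 8) - (- ln (2 * sin (a / 2)) - a\<^sup>2 / 8)"
  proof (rule f''_imp_f'[where C = ?C and f' = "\<lambda>x. - (cot (x / 2) / 2) - x / 4"
        and f'' = "\<lambda>x. inverse ((sin (x / 2))\<^sup>2) / 4 - 1 / 4"])
    fix x assume x: "x \<in> ?C"
    note p = pos[OF x]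
    show "((\<lambda>x. - ln (2 * sin (x / 2)) - x\<^sup>2 / 8) has_real_derivative - (cot (x / 2) / 2) - x / 4) (at x)"
      using p by (auto intro!: derivative_eq_intros simp: cot_def field_simps)
    have "sin (x / 2) \<noteq> 0" using p by simp
    then have "((\<lambda>x. cot (x / 2)) has_real_derivative - inverse ((sin (x / 2))\<^sup>2) * (1 / 2)) (at x)"
      by (intro DERIV_chain2[OF DERIV_cot]) (auto intro!: derivative_eq_intros)
    then show "((\<lambda>x. - (cot (x / 2) / 2) - x / 4) has_real_derivative inverse ((sin (x / 2))\<^sup>2) / 4 - 1 / 4) (at x)"
      by (auto intro!: derivative_eq_intros)
    have "(sin (x / 2))\<^sup>2 \<le> 1" by (simp add: abs_square_le_1)
    then have "1 \<le> inverse ((sin (x / 2))\<^sup>2)" using p by (intro one_le_inverse) auto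
    then show "0 \<le> inverse ((sin (x / 2))\<^sup>2) / 4 - 1 / 4" by simp
  qed (use assms in auto)
  moreover have "(- (cot (a / 2) / 2) - a / 4) * (b - a) = - (cot (a / 2) / 2 * (b - a)) - a / 4 * (b - a)"
    by (simp add: left_diff_distrib)
  moreover have "(b - a)\<^sup>2 / 8 = b\<^sup>2 / 8 - a\<^sup>2 / 8 - a / 4 * (b - a)"
    by (simp add: power2_eq_square field_simps)
  ultimately show ?thesis by linarith
qed

text \<open>Both pairs are in the same order, so after a possible exchange of primed and unprimed
  points both gaps lie in (0, 2 pi), where the sine function of \<open>log_sine_convex\<close> is
  available. Gaps of opposite sign would be separated by the singularity at 0. The exchange
  preserves the inequality because the cotangent is odd.\<close>

lemma log_kernel_displacement_convex:
  fixes x x' y y' :: real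
  assumes "\<bar>x - x'\<bar> < 2 * pi" "\<bar>y - y'\<bar> < 2 * pi" and mono: "x < x' \<Longrightarrow> y \<le> y'" "x' < x \<Longrightarrow> y' \<le> y"
    and ne: "cis x \<noteq> cis x'" "cis y \<noteq> cis y'"
  shows "- ln (norm (cis x - cis x')) - cot ((x - x') / 2) / 2 * ((y - x) - (y' - x')) + ((y - x) - (y' - x'))\<^sup>2 / 8
    \<le> - ln (norm (cis y - cis y'))"
proof -
  have *: "- ln (norm (cis x - cis x')) - cot ((x - x') / 2) / 2 * ((y - x) - (y' - x')) + ((y - x) - (y' - x'))\<^sup>2 / 8
    \<le> - ln (norm (cis y - cis y'))"
    if "x' < x" "y' < y" "x - x' < 2 * pi" "y - y' < 2 * pi" for x x' y y' :: real
  proof -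
    have n: "norm (cis s - cis t) = 2 * sin ((s - t) / 2)" if "t < s" "s - t < 2 * pi" for s t
      using that sin_ge_zero[of "(s - t) / 2"] by (simp add: norm_cis_diff)
    have e: "(y - x) - (y' - x') = (y - y') - (x - x')" by simp
    show ?thesis unfolding e n[OF that(1,3)] n[OF that(2,4)] using that by (intro log_sine_convex) auto
  qed
  have "x \<noteq> x'" "y \<noteq> y'" using ne by auto
  then consider "x' < x" "y' < y" | "x < x'" "y < y'" using mono by linarith
  then show ?thesis
  proof cases
    case 1
    then show ?thesis using assms(1,2) by (intro *) auto
  next
    case 2
    then have "- ln (norm (cis x' - cis x)) - cot ((x' - x) / 2) / 2 * ((y' - x') - (y - x)) + ((y' - x') - (y - x))\<^sup>2 / 8
      \<le> - ln (norm (cis y' - cis y))"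
      using assms(1,2) by (intro *) auto
    moreover have "cot ((x' - x) / 2) / 2 * ((y' - x') - (y - x)) = cot ((x - x') / 2) / 2 * ((y - x) - (y' - x'))"
    proof -
      have "(x' - x) / 2 = - ((x - x') / 2)" by (simp only: minus_divide_left minus_diff_eq)
      moreover have "(y' - x') - (y - x) = - ((y - x) - (y' - x'))" by (simp only: minus_diff_eq)
      ultimately show ?thesis by (simp only: cot_minus mult_minus_left mult_minus_right minus_divide_left[symmetric] minus_minus)
    qed
    ultimately show ?thesis
      by (simp only: norm_minus_commute[of "cis x'"] norm_minus_commute[of "cis y'"] power2_commute[of "y' - x'"])
  qed
qed

text \<open>Subtracting c x^2/2 makes the potential convex in the angle on the whole line, so the
  two angles may come from different windows.\<close>

lemma circle_potential_tangent:
  assumes d: "circle_differentiable Q" "circle_differentiable (circle_deriv Q)"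
    and ge: "\<And>z. z \<in> unit_circle \<Longrightarrow> c \<le> circle_deriv (circle_deriv Q) z"
  shows "circle_deriv Q (cis x) * (y - x) + c / 2 * (y - x)\<^sup>2 \<le> Q (cis y) - Q (cis x)"
proof -
  have "(circle_deriv Q (cis x) - c * x) * (y - x) \<le> (Q (cis y) - c / 2 * y\<^sup>2) - (Q (cis x) - c / 2 * x\<^sup>2)"
  proof (rule f''_imp_f'[where C = UNIV and f' = "\<lambda>x. circle_deriv Q (cis x) - c * x"
        and f'' = "\<lambda>x. circle_deriv (circle_deriv Q) (cis x) - c"])
    fix x
    show "((\<lambda>x. Q (cis x) - c / 2 * x\<^sup>2) has_real_derivative circle_deriv Q (cis x) - c * x) (at x)"
      by (auto intro!: derivative_eq_intros circle_differentiable_DERIV[OF d(1)])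
    show "((\<lambda>x. circle_deriv Q (cis x) - c * x) has_real_derivative circle_deriv (circle_deriv Q) (cis x) - c) (at x)"
      by (auto intro!: derivative_eq_intros circle_differentiable_DERIV[OF d(2)])
  qed (use ge in auto)
  then show ?thesis by (simp add: power2_eq_square algebra_simps diff_divide_distrib add_divide_distrib)
qed

section \<open>Energy along the comonotone coupling\<close>

lemma AE_pair_both:
  assumes "prob_space M" and [measurable]: "Measurable.pred M P" and ae: "AE x in M. P x"
  shows "AE p in M \<Otimes>\<^sub>M M. P (fst p) \<and> P (snd p)"
proof -
  interpret prob_space M by fact
  interpret P: pair_prob_space M M ..
  have "AE x in M. AE y in M. P x \<and> P y"
    using ae by eventually_elim (use ae in eventually_elim, simp)
  then show ?thesis
    by (intro P.AE_pair_measure) simp_all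
qed

lemma integral_mult_le_sqrt:
  fixes f g :: "'a \<Rightarrow> real"
  assumes [measurable]: "f \<in> borel_measurable M" "g \<in> borel_measurable M"
    and int: "integrable M (\<lambda>x. (f x)\<^sup>2)" "integrable M (\<lambda>x. (g x)\<^sup>2)" "integrable M (\<lambda>x. f x * g x)"
  shows "(\<integral>x. f x * g x \<partial>M) \<le> sqrt (\<integral>x. (f x)\<^sup>2 \<partial>M) * sqrt (\<integral>x. (g x)\<^sup>2 \<partial>M)"
proof -
  have abs: "integrable M (\<lambda>x. \<bar>f x\<bar> * \<bar>g x\<bar>)" using integrable_abs[OF int(3)] by (simp add: abs_mult)
  have "(\<integral>\<^sup>+x. ennreal \<bar>f x\<bar> * ennreal \<bar>g x\<bar> \<partial>M)\<^sup>2 \<le> (\<integral>\<^sup>+x. (ennreal \<bar>f x\<bar>)\<^sup>2 \<partial>M) * (\<integral>\<^sup>+x. (ennreal \<bar>g x\<bar>)\<^sup>2 \<partial>M)"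
    by (rule Cauchy_Schwarz_nn_integral) measurable
  also have "(\<integral>\<^sup>+x. ennreal \<bar>f x\<bar> * ennreal \<bar>g x\<bar> \<partial>M) = ennreal (\<integral>x. \<bar>f x\<bar> * \<bar>g x\<bar> \<partial>M)"
    using abs by (simp add: nn_integral_eq_integral flip: ennreal_mult)
  also have "(\<integral>\<^sup>+x. (ennreal \<bar>f x\<bar>)\<^sup>2 \<partial>M) = ennreal (\<integral>x. (f x)\<^sup>2 \<partial>M)"
    using int by (simp add: nn_integral_eq_integral ennreal_power)
  also have "(\<integral>\<^sup>+x. (ennreal \<bar>g x\<bar>)\<^sup>2 \<partial>M) = ennreal (\<integral>x. (g x)\<^sup>2 \<partial>M)"
    using int by (simp add: nn_integral_eq_integral ennreal_power)
  finally have "(\<integral>x. \<bar>f x\<bar> * \<bar>g x\<bar> \<partial>M)\<^sup>2 \<le> (\<integral>x. (f x)\<^sup>2 \<partial>M) * (\<integral>x. (g x)\<^sup>2 \<partial>M)"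
    by (simp add: ennreal_power flip: ennreal_mult)
  then have "(\<integral>x. \<bar>f x\<bar> * \<bar>g x\<bar> \<partial>M) \<le> sqrt (\<integral>x. (f x)\<^sup>2 \<partial>M) * sqrt (\<integral>x. (g x)\<^sup>2 \<partial>M)"
    by (simp add: real_le_rsqrt flip: real_sqrt_mult)
  moreover have "(\<integral>x. f x * g x \<partial>M) \<le> (\<integral>x. \<bar>f x\<bar> * \<bar>g x\<bar> \<partial>M)"
    using abs_ge_self[of "f _ * g _"] by (intro integral_mono int abs) (simp add: abs_mult)
  ultimately show ?thesis by linarith
qed

text \<open>The arcs hold almost everywhere, since the quantile functions are controlled through
  their laws. Comonotonicity is a condition on all pairs of sample points, as it is used pointwise
  under the integral over pairs.\<close>

locale circle_coupling = prob_space M for M :: "'a measure" +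
  fixes X Y :: "'a \<Rightarrow> real" and u v :: real and m :: "complex \<Rightarrow> real" and L :: real
  assumes X_meas [measurable]: "X \<in> borel_measurable M" and Y_meas [measurable]: "Y \<in> borel_measurable M"
    and comon: "comonotone_on (space M) X Y"
    and X_arc: "AE \<omega> in M. u \<le> X \<omega> \<and> X \<omega> < u + 2 * pi" and Y_arc: "AE \<omega> in M. v \<le> Y \<omega> \<and> Y \<omega> < v + 2 * pi"
    and m_meas [measurable]: "m \<in> borel_measurable circle_borel" and m_nonneg: "\<And>z. z \<in> unit_circle \<Longrightarrow> 0 \<le> m z"
    and Lip: "\<And>s t. \<bar>m (cis s) - m (cis t)\<bar> \<le> L * \<bar>s - t\<bar>" and L_nonneg: "0 \<le> L"
    and X_density: "distr M circle_borel (\<lambda>\<omega>. cis (X \<omega>)) = density circle_haar (\<lambda>z. ennreal (m z))"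
    and X_energy: "log_energy (distr M circle_borel (\<lambda>\<omega>. cis (X \<omega>))) \<noteq> \<infinity>"
    and Y_energy: "log_energy (distr M circle_borel (\<lambda>\<omega>. cis (Y \<omega>))) \<noteq> \<infinity>"
    and means: "(\<integral>\<omega>. X \<omega> \<partial>M) = (\<integral>\<omega>. Y \<omega> \<partial>M)"
begin

sublocale P: pair_prob_space M M ..

definition "D \<omega> = Y \<omega> - X \<omega>"
definition "H \<omega> = hilbert_reg m (cis (X \<omega>))"

lemma D_meas [measurable]: "D \<in> borel_measurable M" unfolding D_def[abs_def] by measurable

lemma H_meas [measurable]: "H \<in> borel_measurable M"
proof -
  note hilbert_reg_measurable[OF m_meas, measurable]
  show ?thesis unfolding H_def[abs_def] by measurable
qed

definition "B = \<bar>v - u\<bar> + 2 * pi"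

lemma B_nonneg: "0 \<le> B" by (simp add: B_def)

lemma D_bound: "AE \<omega> in M. \<bar>D \<omega>\<bar> \<le> B"
  using X_arc Y_arc by eventually_elim (unfold D_def B_def, linarith)

lemma H_bound: "\<bar>H \<omega>\<bar> \<le> 8 * pi * L"
  unfolding H_def by (rule abs_hilbert_reg_le[OF m_meas Lip L_nonneg]) simp

lemma integrable_X: "integrable M X"
proof (rule integrable_const_bound[where B = "\<bar>u\<bar> + 2 * pi"])
  show "AE \<omega> in M. norm (X \<omega>) \<le> \<bar>u\<bar> + 2 * pi"
    using X_arc by eventually_elim (unfold real_norm_def, linarith)
qed measurable

lemma integrable_Y: "integrable M Y"
proof (rule integrable_const_bound[where B = "\<bar>v\<bar> + 2 * pi"])
  show "AE \<omega> in M. norm (Y \<omega>) \<le> \<bar>v\<bar> + 2 * pi"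
    using Y_arc by eventually_elim (unfold real_norm_def, linarith)
qed measurable

lemma integral_D: "(\<integral>\<omega>. D \<omega> \<partial>M) = 0"
  unfolding D_def using means integrable_X integrable_Y by simp

lemma integrable_D: "integrable M D"
  using D_bound by (intro integrable_const_bound[where B = B]) auto

lemma integrable_D2: "integrable M (\<lambda>\<omega>. (D \<omega>)\<^sup>2)"
proof (rule integrable_const_bound[where B = "B\<^sup>2"])
  show "AE \<omega> in M. norm ((D \<omega>)\<^sup>2) \<le> B\<^sup>2"
    using D_bound by eventually_elim (auto simp: abs_le_square_iff[symmetric] B_nonneg)
qed measurable

lemma integrable_H: "integrable M H"
  using H_bound by (intro integrable_const_bound[where B = "8 * pi * L"]) auto

text \<open>The double integral is symmetrised: \<open>cot_trunc\<close> is odd, and Fubini's theorem turns the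
  inner integral into the truncated Hilbert transform.\<close>

lemma integral_cot_trunc_pair:
  assumes e: "0 < \<epsilon>" "\<epsilon> \<le> pi" and [measurable]: "F \<in> borel_measurable M" and F: "AE \<omega> in M. \<bar>F \<omega>\<bar> \<le> C"
  shows "integrable (M \<Otimes>\<^sub>M M) (\<lambda>p. cot_trunc \<epsilon> (X (fst p) - X (snd p)) * (F (fst p) - F (snd p)))"
    and "(\<integral>p. cot_trunc \<epsilon> (X (fst p) - X (snd p)) * (F (fst p) - F (snd p)) \<partial>(M \<Otimes>\<^sub>M M)) =
      2 * (\<integral>\<omega>. F \<omega> * hilbert_trunc m \<epsilon> (cis (X \<omega>)) \<partial>M)"
proof -
  let ?k = "\<lambda>p. cot_trunc \<epsilon> (X (fst p) - X (snd p))"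
  have inner: "(\<integral>t. cot_trunc \<epsilon> (X s - X t) \<partial>M) = hilbert_trunc m \<epsilon> (cis (X s))" for s
  proof -
    have [measurable]: "Arg2pi \<in> borel_measurable circle_borel"
      by (rule measurable_circle_borelI) (rule borel_measurable_Arg2pi)
    \<comment> \<open>The density describes the law of the point \<open>cis (X t)\<close>, so the
      kernel has to be written as a function of that point.\<close>
    have "cot_trunc \<epsilon> (X s - Arg2pi (cis (X t))) = cot_trunc \<epsilon> (X s - X t)" for t
      by (rule cot_trunc_period) (simp add: cis_divide[symmetric] cis_Arg2pi)
    then have "(\<integral>t. cot_trunc \<epsilon> (X s - X t) \<partial>M) = (\<integral>t. cot_trunc \<epsilon> (X s - Arg2pi (cis (X t))) \<partial>M)"
      by simp
    also have "\<dots> = (\<integral>z. cot_trunc \<epsilon> (X s - Arg2pi z) \<partial>distr M circle_borel (\<lambda>\<omega>. cis (X \<omega>)))"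
      by (subst integral_distr) auto
    also have "\<dots> = hilbert_trunc m \<epsilon> (cis (X s))"
      unfolding X_density by (rule integral_cot_trunc[OF m_meas Lip L_nonneg e m_nonneg])
    finally show ?thesis .
  qed
  have "AE p in M \<Otimes>\<^sub>M M. \<bar>F (fst p)\<bar> \<le> C \<and> \<bar>F (snd p)\<bar> \<le> C"
    by (rule AE_pair_both[OF prob_space_axioms _ F]) measurable
  then have ae: "AE p in M \<Otimes>\<^sub>M M. \<bar>?k p * F (fst p)\<bar> \<le> 1 / sin (\<epsilon> / 2) * C \<and> \<bar>?k p * F (snd p)\<bar> \<le> 1 / sin (\<epsilon> / 2) * C"
  proof eventually_elim
    case (elim p)
    have "0 \<le> 1 / sin (\<epsilon> / 2)" using cot_trunc_bound[OF e, of 0] by linarith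
    then show ?case using elim cot_trunc_bound[OF e, of "X (fst p) - X (snd p)"]
      unfolding abs_mult by (intro conjI mult_mono) auto
  qed
  have i1: "integrable (M \<Otimes>\<^sub>M M) (\<lambda>p. ?k p * F (fst p))"
    using ae by (intro P.integrable_const_bound[where B = "1 / sin (\<epsilon> / 2) * C"]) auto
  have i2: "integrable (M \<Otimes>\<^sub>M M) (\<lambda>p. ?k p * F (snd p))"
    using ae by (intro P.integrable_const_bound[where B = "1 / sin (\<epsilon> / 2) * C"]) auto
  show "integrable (M \<Otimes>\<^sub>M M) (\<lambda>p. ?k p * (F (fst p) - F (snd p)))"
    using Bochner_Integration.integrable_diff[OF i1 i2] by (simp add: right_diff_distrib)
  have "(\<integral>p. ?k p * F (fst p) \<partial>(M \<Otimes>\<^sub>M M)) = (\<integral>s. (\<integral>t. cot_trunc \<epsilon> (X s - X t) * F s \<partial>M) \<partial>M)"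
    using P.integral_fst'[OF i1] by simp
  also have "\<dots> = (\<integral>\<omega>. F \<omega> * hilbert_trunc m \<epsilon> (cis (X \<omega>)) \<partial>M)"
    by (simp add: inner mult.commute)
  finally have 1: "(\<integral>p. ?k p * F (fst p) \<partial>(M \<Otimes>\<^sub>M M)) = (\<integral>\<omega>. F \<omega> * hilbert_trunc m \<epsilon> (cis (X \<omega>)) \<partial>M)" .
  have "(\<integral>p. ?k p * F (snd p) \<partial>(M \<Otimes>\<^sub>M M)) = (\<integral>t. (\<integral>s. cot_trunc \<epsilon> (X s - X t) * F t \<partial>M) \<partial>M)"
    using P.integral_snd[of "\<lambda>s t. cot_trunc \<epsilon> (X s - X t) * F t"] i2 by (simp add: split_beta')
  also have "\<dots> = (\<integral>t. (\<integral>s. - (cot_trunc \<epsilon> (X t - X s)) * F t \<partial>M) \<partial>M)"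
  proof -
    have e: "cot_trunc \<epsilon> (X s - X t) = - cot_trunc \<epsilon> (X t - X s)" for s t
      using cot_trunc_minus[of \<epsilon> "X t - X s"] by simp
    show ?thesis by (intro Bochner_Integration.integral_cong refl, subst e) (rule refl)
  qed
  also have "\<dots> = - (\<integral>\<omega>. F \<omega> * hilbert_trunc m \<epsilon> (cis (X \<omega>)) \<partial>M)"
    by (simp add: inner mult.commute)
  finally show "(\<integral>p. ?k p * (F (fst p) - F (snd p)) \<partial>(M \<Otimes>\<^sub>M M)) = 2 * (\<integral>\<omega>. F \<omega> * hilbert_trunc m \<epsilon> (cis (X \<omega>)) \<partial>M)"
    using 1 i1 i2 by (simp add: right_diff_distrib)
qed

text \<open>A null sequence in (0, pi], as dominated convergence is applied along sequences and the
  truncation estimates require \<epsilon> \<le> pi.\<close>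

definition eps :: "nat \<Rightarrow> real" where "eps n = 1 / (real n + 1)"

lemma eps: "0 < eps n" "eps n \<le> 1" "eps n \<le> pi" "eps \<longlonglongrightarrow> 0"
proof -
  show "0 < eps n" "eps n \<le> 1" by (auto simp: eps_def)
  then show "eps n \<le> pi" using pi_gt3 by linarith
  show "eps \<longlonglongrightarrow> 0" unfolding eps_def[abs_def] using LIMSEQ_inverse_real_of_nat by (simp add: inverse_eq_divide add.commute)
qed

text \<open>The uniform rate of truncation gives the pointwise limit and, with the bound on
  \<open>H\<close>, also a constant majorant.\<close>

lemma hilbert_trunc_tendsto:
  assumes [measurable]: "F \<in> borel_measurable M" and F: "AE \<omega> in M. \<bar>F \<omega>\<bar> \<le> C"
  shows "(\<lambda>n. \<integral>\<omega>. F \<omega> * hilbert_trunc m (eps n) (cis (X \<omega>)) \<partial>M) \<longlonglongrightarrow> (\<integral>\<omega>. F \<omega> * H \<omega> \<partial>M)"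
proof (rule integral_dominated_convergence[where w = "\<lambda>_. \<bar>C\<bar> * (8 * L + 8 * pi * L)"])
  have diff: "\<bar>hilbert_trunc m (eps n) (cis (X \<omega>)) - H \<omega>\<bar> \<le> 8 * L * eps n" for n \<omega>
    unfolding H_def by (rule abs_hilbert_trunc_diff_le[OF m_meas Lip L_nonneg _ eps(1,3)]) simp
  show "(\<lambda>\<omega>. F \<omega> * hilbert_trunc m (eps n) (cis (X \<omega>))) \<in> borel_measurable M" for n
  proof -
    note hilbert_trunc_measurable[OF m_meas, measurable]
    show ?thesis by measurable
  qed
  show "AE \<omega> in M. norm (F \<omega> * hilbert_trunc m (eps n) (cis (X \<omega>))) \<le> \<bar>C\<bar> * (8 * L + 8 * pi * L)" for n
    using F
  proof eventually_elim
    case (elim \<omega>)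
    have "8 * L * eps n \<le> 8 * L" using mult_left_mono[OF eps(2)[of n], of "8 * L"] L_nonneg by simp
    then have h: "\<bar>hilbert_trunc m (eps n) (cis (X \<omega>))\<bar> \<le> 8 * L + 8 * pi * L"
      using diff[of n \<omega>] H_bound[of \<omega>] by linarith
    have "\<bar>F \<omega>\<bar> \<le> \<bar>C\<bar>" using elim by (rule order_trans) (rule abs_ge_self)
    then show ?case unfolding real_norm_def abs_mult by (rule mult_mono[OF _ h abs_ge_zero abs_ge_zero])
  qed
  show "AE \<omega> in M. (\<lambda>n. F \<omega> * hilbert_trunc m (eps n) (cis (X \<omega>))) \<longlonglongrightarrow> F \<omega> * H \<omega>"
  proof (rule AE_I2, rule tendsto_mult[OF tendsto_const], rule LIM_zero_cancel, rule Lim_null_comparison)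
    fix \<omega>
    show "\<forall>\<^sub>F n in sequentially. norm (hilbert_trunc m (eps n) (cis (X \<omega>)) - H \<omega>) \<le> 8 * L * eps n"
      unfolding real_norm_def by (rule always_eventually) (rule allI, rule diff)
    show "(\<lambda>n. 8 * L * eps n) \<longlonglongrightarrow> 0" using tendsto_mult_left[OF eps(4), of "8 * L"] by simp
  qed
  show "(\<lambda>\<omega>. F \<omega> * H \<omega>) \<in> borel_measurable M" by measurable
  show "integrable M (\<lambda>_. \<bar>C\<bar> * (8 * L + 8 * pi * L))" by (rule integrable_const)
qed

text \<open>For F = 1 the symmetrised integrand contains the factor F s - F t = 0, so already every
  truncated integral vanishes.\<close>

lemma integral_H: "(\<integral>\<omega>. H \<omega> \<partial>M) = 0"
proof -
  have "(\<integral>\<omega>. hilbert_trunc m (eps n) (cis (X \<omega>)) \<partial>M) = 0" for n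
    using integral_cot_trunc_pair(2)[OF eps(1,3), of "\<lambda>_. 1" 1] by simp
  then show ?thesis using hilbert_trunc_tendsto[of "\<lambda>_. 1" 1] by (simp add: LIMSEQ_const_iff)
qed

text \<open>The cross term is the squared mean of \<open>D\<close>, which vanishes because the lifts
  have equal means. One second moment remains for each coordinate.\<close>

lemma integral_D_diff_squared:
  "integrable (M \<Otimes>\<^sub>M M) (\<lambda>p. (D (fst p) - D (snd p))\<^sup>2)"
  "(\<integral>p. (D (fst p) - D (snd p))\<^sup>2 \<partial>(M \<Otimes>\<^sub>M M)) = 2 * (\<integral>\<omega>. (D \<omega>)\<^sup>2 \<partial>M)"
proof -
  have bd: "AE p in M \<Otimes>\<^sub>M M. \<bar>D (fst p)\<bar> \<le> B \<and> \<bar>D (snd p)\<bar> \<le> B"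
    by (rule AE_pair_both[OF prob_space_axioms _ D_bound]) measurable
  have i1: "integrable (M \<Otimes>\<^sub>M M) (\<lambda>p. (D (fst p))\<^sup>2)"
  proof (rule P.integrable_const_bound[where B = "B * B"])
    show "AE p in M \<Otimes>\<^sub>M M. norm ((D (fst p))\<^sup>2) \<le> B * B"
      using bd by eventually_elim (unfold power2_eq_square real_norm_def abs_mult, intro mult_mono, auto)
  qed measurable
  have i2: "integrable (M \<Otimes>\<^sub>M M) (\<lambda>p. (D (snd p))\<^sup>2)"
  proof (rule P.integrable_const_bound[where B = "B * B"])
    show "AE p in M \<Otimes>\<^sub>M M. norm ((D (snd p))\<^sup>2) \<le> B * B"
      using bd by eventually_elim (unfold power2_eq_square real_norm_def abs_mult, intro mult_mono, auto)
  qed measurable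
  have i3: "integrable (M \<Otimes>\<^sub>M M) (\<lambda>p. D (fst p) * D (snd p))"
  proof (rule P.integrable_const_bound[where B = "B * B"])
    show "AE p in M \<Otimes>\<^sub>M M. norm (D (fst p) * D (snd p)) \<le> B * B"
      using bd by eventually_elim (unfold power2_eq_square real_norm_def abs_mult, intro mult_mono, auto)
  qed measurable
  show "integrable (M \<Otimes>\<^sub>M M) (\<lambda>p. (D (fst p) - D (snd p))\<^sup>2)"
    using i1 i2 i3 by (simp add: power2_diff mult.assoc)
  have "(\<integral>p. (D (fst p) - D (snd p))\<^sup>2 \<partial>(M \<Otimes>\<^sub>M M)) =
    (\<integral>p. (D (fst p))\<^sup>2 \<partial>(M \<Otimes>\<^sub>M M)) + (\<integral>p. (D (snd p))\<^sup>2 \<partial>(M \<Otimes>\<^sub>M M)) - 2 * (\<integral>p. D (fst p) * D (snd p) \<partial>(M \<Otimes>\<^sub>M M))"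
    using i1 i2 i3 by (simp add: power2_diff mult.assoc)
  also have "(\<integral>p. (D (fst p))\<^sup>2 \<partial>(M \<Otimes>\<^sub>M M)) = (\<integral>\<omega>. (D \<omega>)\<^sup>2 \<partial>M)"
    using P.integral_fst'[OF i1] by (simp add: prob_space)
  also have "(\<integral>p. (D (snd p))\<^sup>2 \<partial>(M \<Otimes>\<^sub>M M)) = (\<integral>\<omega>. (D \<omega>)\<^sup>2 \<partial>M)"
    using P.integral_snd[of "\<lambda>s t. (D t)\<^sup>2"] i2 by (simp add: split_beta' prob_space)
  also have "(\<integral>p. D (fst p) * D (snd p) \<partial>(M \<Otimes>\<^sub>M M)) = 0"
    using P.integral_fst'[OF i3] by (simp add: integral_D)
  finally show "(\<integral>p. (D (fst p) - D (snd p))\<^sup>2 \<partial>(M \<Otimes>\<^sub>M M)) = 2 * (\<integral>\<omega>. (D \<omega>)\<^sup>2 \<partial>M)" by simp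
qed

definition "fX p = - ln (norm (cis (X (fst p)) - cis (X (snd p))))"
definition "fY p = - ln (norm (cis (Y (fst p)) - cis (Y (snd p))))"

lemma cis_XY_meas: "(\<lambda>\<omega>. cis (X \<omega>)) \<in> measurable M circle_borel" "(\<lambda>\<omega>. cis (Y \<omega>)) \<in> measurable M circle_borel"
  by measurable

lemmas X_log = log_energy_distr[OF prob_space_axioms cis_XY_meas(1) X_energy, folded fX_def[abs_def]]
lemmas Y_log = log_energy_distr[OF prob_space_axioms cis_XY_meas(2) Y_energy, folded fY_def[abs_def]]

text \<open>Two factors 2 fix the constants: symmetrisation of the cotangent integral cancels the
  1/2 in the derivative cot(t/2)/2, and \<open>integral_D_diff_squared\<close> turns 1/8 into
  1/4.\<close>

lemma interaction_energy_diff: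
  "- (\<integral>\<omega>. D \<omega> * H \<omega> \<partial>M) + (\<integral>\<omega>. (D \<omega>)\<^sup>2 \<partial>M) / 4 \<le> (\<integral>p. fY p \<partial>(M \<Otimes>\<^sub>M M)) - (\<integral>p. fX p \<partial>(M \<Otimes>\<^sub>M M))"
proof -
  let ?P = "M \<Otimes>\<^sub>M M"
  \<comment> \<open>The cut-off criterion of \<open>cot_trunc\<close> as a separate factor:
    multiplied by it, the cotangent becomes the truncated one, and being 0 or 1 it preserves the
    inequality.\<close>
  define A :: "nat \<Rightarrow> 'a \<times> 'a \<Rightarrow> real" where "A n p = (if sin (eps n / 2) \<le> \<bar>sin ((X (fst p) - X (snd p)) / 2)\<bar> then 1 else 0)" for n p
  define G where "G p = D (fst p) - D (snd p)" for p
  have [measurable]: "A n \<in> borel_measurable ?P" for n unfolding A_def[abs_def] by measurable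
  have [measurable]: "G \<in> borel_measurable ?P" unfolding G_def[abs_def] by measurable
  have intd: "integrable ?P (\<lambda>p. fY p - fX p)" using X_log(1) Y_log(1) by simp
  have intG: "integrable ?P (\<lambda>p. (G p)\<^sup>2)" unfolding G_def by (rule integral_D_diff_squared)
  have intA: "integrable ?P (\<lambda>p. A n p * f p)" if "integrable ?P f" for n and f :: "_ \<Rightarrow> real"
  proof (rule Bochner_Integration.integrable_bound[OF that])
    show "AE p in ?P. norm (A n p * f p) \<le> norm (f p)" by (auto simp: A_def)
    have [measurable]: "f \<in> borel_measurable ?P" using that by simp
    show "(\<lambda>p. A n p * f p) \<in> borel_measurable ?P" by measurable
  qed
  have limA: "(\<lambda>n. \<integral>p. A n p * f p \<partial>?P) \<longlonglongrightarrow> (\<integral>p. f p \<partial>?P)" if f: "integrable ?P f" for f :: "_ \<Rightarrow> real"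
  proof (rule integral_dominated_convergence[where w = "\<lambda>p. \<bar>f p\<bar>"])
    show "AE p in ?P. (\<lambda>n. A n p * f p) \<longlonglongrightarrow> f p"
      using X_log(2)
    proof eventually_elim
      case (elim p)
      let ?s = "\<bar>sin ((X (fst p) - X (snd p)) / 2)\<bar>"
      \<comment> \<open>Finite energy keeps almost every pair off the diagonal, so each such pair
        eventually passes the cut-off.\<close>
      have "0 < ?s" using elim norm_cis_diff[of "X (fst p)" "X (snd p)"] by auto
      moreover have "(\<lambda>n. sin (eps n / 2)) \<longlonglongrightarrow> 0"
        using tendsto_sin[OF tendsto_divide[OF eps(4) tendsto_const[of "2::real"]]] by simp
      ultimately have "\<forall>\<^sub>F n in sequentially. sin (eps n / 2) < ?s" by (rule order_tendstoD(2)[rotated])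
      then have "\<forall>\<^sub>F n in sequentially. A n p * f p = f p" by (rule eventually_mono) (simp add: A_def)
      then show ?case by (rule tendsto_eventually)
    qed
    show "AE p in ?P. norm (A n p * f p) \<le> \<bar>f p\<bar>" for n by (auto simp: A_def)
    show "(\<lambda>p. A n p * f p) \<in> borel_measurable ?P" for n using intA[OF f] by simp
  qed (use f in auto)
  have le: "- (\<integral>\<omega>. D \<omega> * hilbert_trunc m (eps n) (cis (X \<omega>)) \<partial>M) + (\<integral>p. A n p * (G p)\<^sup>2 \<partial>?P) / 8 \<le> (\<integral>p. A n p * (fY p - fX p) \<partial>?P)" for n
  proof -
    let ?K = "\<lambda>p. cot_trunc (eps n) (X (fst p) - X (snd p)) * G p"
    have K: "integrable ?P ?K" "(\<integral>p. ?K p \<partial>?P) = 2 * (\<integral>\<omega>. D \<omega> * hilbert_trunc m (eps n) (cis (X \<omega>)) \<partial>M)"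
      unfolding G_def by (rule integral_cot_trunc_pair[OF eps(1,3) D_meas D_bound])+
    have "(\<integral>p. - (?K p / 2) + A n p * (G p)\<^sup>2 / 8 \<partial>?P) \<le> (\<integral>p. A n p * (fY p - fX p) \<partial>?P)"
    proof (rule integral_mono_AE)
      have arcX: "AE p in ?P. (u \<le> X (fst p) \<and> X (fst p) < u + 2 * pi) \<and> (u \<le> X (snd p) \<and> X (snd p) < u + 2 * pi)"
        by (rule AE_pair_both[OF prob_space_axioms _ X_arc]) measurable
      have arcY: "AE p in ?P. (v \<le> Y (fst p) \<and> Y (fst p) < v + 2 * pi) \<and> (v \<le> Y (snd p) \<and> Y (snd p) < v + 2 * pi)"
        by (rule AE_pair_both[OF prob_space_axioms _ Y_arc]) measurable
      show "AE p in ?P. - (?K p / 2) + A n p * (G p)\<^sup>2 / 8 \<le> A n p * (fY p - fX p)"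
        using X_log(2) Y_log(2) arcX arcY AE_space
      proof eventually_elim
        case (elim p)
        let ?x = "X (fst p)" and ?x' = "X (snd p)" and ?y = "Y (fst p)" and ?y' = "Y (snd p)"
        have "fst p \<in> space M" "snd p \<in> space M" using elim(5) by (auto simp: space_pair_measure)
        then have mono: "?x < ?x' \<Longrightarrow> ?y \<le> ?y'" "?x' < ?x \<Longrightarrow> ?y' \<le> ?y"
          using comon by (auto simp: comonotone_on_def)
        have "- ln (norm (cis ?x - cis ?x')) - cot ((?x - ?x') / 2) / 2 * ((?y - ?x) - (?y' - ?x')) + ((?y - ?x) - (?y' - ?x'))\<^sup>2 / 8
          \<le> - ln (norm (cis ?y - cis ?y'))"
        proof (rule log_kernel_displacement_convex[OF _ _ mono])
          show "\<bar>?x - ?x'\<bar> < 2 * pi" using elim(3) by linarith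
          show "\<bar>?y - ?y'\<bar> < 2 * pi" using elim(4) by linarith
        qed (use elim in blast)+
        then have "- (cot ((?x - ?x') / 2) / 2 * G p) + (G p)\<^sup>2 / 8 \<le> fY p - fX p"
          by (simp add: G_def D_def fX_def fY_def)
        then show ?case by (simp add: A_def cot_trunc_def)
      qed
    qed (use K(1) intA[OF intG] intA[OF intd] in auto)
    also have "(\<integral>p. - (?K p / 2) + A n p * (G p)\<^sup>2 / 8 \<partial>?P) = - ((\<integral>p. ?K p \<partial>?P) / 2) + (\<integral>p. A n p * (G p)\<^sup>2 \<partial>?P) / 8"
      using K(1) intA[OF intG, of n] by simp
    finally show ?thesis by (simp add: K(2))
  qed
  have "(\<lambda>n. - (\<integral>\<omega>. D \<omega> * hilbert_trunc m (eps n) (cis (X \<omega>)) \<partial>M) + (\<integral>p. A n p * (G p)\<^sup>2 \<partial>?P) / 8)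
     \<longlonglongrightarrow> - (\<integral>\<omega>. D \<omega> * H \<omega> \<partial>M) + (\<integral>p. (G p)\<^sup>2 \<partial>?P) / 8"
    by (intro tendsto_intros hilbert_trunc_tendsto[OF D_meas D_bound] limA intG) simp
  from LIMSEQ_le[OF this limA[OF intd]] le
  have "- (\<integral>\<omega>. D \<omega> * H \<omega> \<partial>M) + (\<integral>p. (G p)\<^sup>2 \<partial>?P) / 8 \<le> (\<integral>p. fY p - fX p \<partial>?P)" by blast
  then show ?thesis
    using X_log(1) Y_log(1) integral_D_diff_squared(2) by (simp add: G_def)
qed

end

text \<open>To the coefficient of the second moment of \<open>D\<close> the potential contributes
  (\<rho> - 1/2)/2 and the interaction 1/4, together \<rho>/2. The remaining linear terms pair
  \<open>H - q\<close> with \<open>D\<close>.\<close>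

lemma (in circle_coupling) free_HWI_coupling:
  fixes Q :: "complex \<Rightarrow> real"
  assumes d: "circle_differentiable Q" "circle_differentiable (circle_deriv Q)"
    and conv: "\<And>z. z \<in> unit_circle \<Longrightarrow> \<rho> - 1 / 2 \<le> circle_deriv (circle_deriv Q) z"
  defines "q \<equiv> \<lambda>\<omega>. circle_deriv Q (cis (X \<omega>))"
  shows "((\<integral>\<omega>. Q (cis (X \<omega>)) \<partial>M) + (\<integral>p. fX p \<partial>(M \<Otimes>\<^sub>M M))) - ((\<integral>\<omega>. Q (cis (Y \<omega>)) \<partial>M) + (\<integral>p. fY p \<partial>(M \<Otimes>\<^sub>M M)))
    \<le> sqrt ((\<integral>\<omega>. (H \<omega> - q \<omega>)\<^sup>2 \<partial>M) - (\<integral>\<omega>. q \<omega> \<partial>M)\<^sup>2) * sqrt (\<integral>\<omega>. (D \<omega>)\<^sup>2 \<partial>M) - \<rho> / 2 * (\<integral>\<omega>. (D \<omega>)\<^sup>2 \<partial>M)"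
proof -
  note circle_differentiable_measurable[OF d(1), measurable] circle_differentiable_measurable[OF d(2), measurable]
  obtain C1 where C1: "\<And>z. z \<in> unit_circle \<Longrightarrow> \<bar>Q z\<bar> \<le> C1" using circle_differentiable_bounded[OF d(1)] by blast
  obtain C2 where C2: "\<And>z. z \<in> unit_circle \<Longrightarrow> \<bar>circle_deriv Q z\<bar> \<le> C2" using circle_differentiable_bounded[OF d(2)] by blast
  have [measurable]: "q \<in> borel_measurable M" unfolding q_def by measurable
  have qb: "\<bar>q \<omega>\<bar> \<le> C2" for \<omega> unfolding q_def by (rule C2) simp
  have intq: "integrable M q"
    by (rule integrable_const_bound[where B = C2]) (use qb in simp_all)
  have intQ: "integrable M (\<lambda>\<omega>. Q (cis (X \<omega>)))" "integrable M (\<lambda>\<omega>. Q (cis (Y \<omega>)))"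
    by (rule integrable_const_bound[where B = C1]; use C1 in simp)+
  have intqD: "integrable M (\<lambda>\<omega>. q \<omega> * D \<omega>)"
  proof (rule integrable_const_bound[where B = "C2 * B"])
    show "AE \<omega> in M. norm (q \<omega> * D \<omega>) \<le> C2 * B"
      using D_bound by eventually_elim (unfold real_norm_def abs_mult, intro mult_mono qb, auto intro: order_trans[OF abs_ge_zero qb])
  qed measurable
  have intHD: "integrable M (\<lambda>\<omega>. D \<omega> * H \<omega>)"
  proof (rule integrable_const_bound[where B = "B * (8 * pi * L)"])
    show "AE \<omega> in M. norm (D \<omega> * H \<omega>) \<le> B * (8 * pi * L)"
      using D_bound by eventually_elim (unfold real_norm_def abs_mult, intro mult_mono H_bound, auto simp: B_nonneg)
  qed measurable
  have pot: "(\<integral>\<omega>. q \<omega> * D \<omega> \<partial>M) + (\<rho> - 1 / 2) / 2 * (\<integral>\<omega>. (D \<omega>)\<^sup>2 \<partial>M) \<le> (\<integral>\<omega>. Q (cis (Y \<omega>)) \<partial>M) - (\<integral>\<omega>. Q (cis (X \<omega>)) \<partial>M)"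
  proof -
    have "(\<integral>\<omega>. q \<omega> * D \<omega> + (\<rho> - 1 / 2) / 2 * (D \<omega>)\<^sup>2 \<partial>M) \<le> (\<integral>\<omega>. Q (cis (Y \<omega>)) - Q (cis (X \<omega>)) \<partial>M)"
    proof (rule integral_mono)
      show "integrable M (\<lambda>\<omega>. q \<omega> * D \<omega> + (\<rho> - 1 / 2) / 2 * (D \<omega>)\<^sup>2)"
        by (intro Bochner_Integration.integrable_add intqD integrable_mult_right integrable_D2)
      show "integrable M (\<lambda>\<omega>. Q (cis (Y \<omega>)) - Q (cis (X \<omega>)))"
        by (intro Bochner_Integration.integrable_diff intQ)
      show "q \<omega> * D \<omega> + (\<rho> - 1 / 2) / 2 * (D \<omega>)\<^sup>2 \<le> Q (cis (Y \<omega>)) - Q (cis (X \<omega>))" for \<omega>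
        unfolding q_def D_def by (rule circle_potential_tangent[OF d conv])
    qed
    also have "(\<integral>\<omega>. q \<omega> * D \<omega> + (\<rho> - 1 / 2) / 2 * (D \<omega>)\<^sup>2 \<partial>M) = (\<integral>\<omega>. q \<omega> * D \<omega> \<partial>M) + (\<rho> - 1 / 2) / 2 * (\<integral>\<omega>. (D \<omega>)\<^sup>2 \<partial>M)"
      by (subst Bochner_Integration.integral_add[OF intqD integrable_mult_right[OF integrable_D2]]) simp
    also have "(\<integral>\<omega>. Q (cis (Y \<omega>)) - Q (cis (X \<omega>)) \<partial>M) = (\<integral>\<omega>. Q (cis (Y \<omega>)) \<partial>M) - (\<integral>\<omega>. Q (cis (X \<omega>)) \<partial>M)"
      by (rule Bochner_Integration.integral_diff[OF intQ(2,1)])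
    finally show ?thesis .
  qed
  \<comment> \<open>This is the mean of \<open>H - q\<close>, as \<open>H\<close> integrates to 0.
    Subtracting it does not change the pairing with \<open>D\<close>, and it turns the second moment
    of \<open>H - q\<close> into its variance, which is the expression under the root.\<close>
  define c where "c = - (\<integral>\<omega>. q \<omega> \<partial>M)"
  define g where "g \<omega> = H \<omega> - q \<omega> - c" for \<omega>
  have [measurable]: "g \<in> borel_measurable M" unfolding g_def[abs_def] by measurable
  have intHq: "integrable M (\<lambda>\<omega>. H \<omega> - q \<omega>)"
    by (intro Bochner_Integration.integrable_diff integrable_H intq)
  have intHq2: "integrable M (\<lambda>\<omega>. (H \<omega> - q \<omega>)\<^sup>2)"
  proof (rule integrable_const_bound[where B = "(8 * pi * L + C2)\<^sup>2"])
    have "\<bar>H \<omega> - q \<omega>\<bar> \<le> 8 * pi * L + C2" for \<omega> using H_bound[of \<omega>] qb[of \<omega>] by linarith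
    from power_mono[OF this abs_ge_zero, where n = 2]
    show "AE \<omega> in M. norm ((H \<omega> - q \<omega>)\<^sup>2) \<le> (8 * pi * L + C2)\<^sup>2" by (intro AE_I2) simp
  qed measurable
  have g2: "(\<lambda>\<omega>. (g \<omega>)\<^sup>2) = (\<lambda>\<omega>. (H \<omega> - q \<omega>)\<^sup>2 - 2 * c * (H \<omega> - q \<omega>) + c\<^sup>2)"
    by (rule ext) (simp add: g_def power2_eq_square algebra_simps)
  have intg2: "integrable M (\<lambda>\<omega>. (g \<omega>)\<^sup>2)"
    unfolding g2 by (intro Bochner_Integration.integrable_add Bochner_Integration.integrable_diff intHq2 integrable_mult_right intHq) simp
  have Hq: "(\<integral>\<omega>. H \<omega> - q \<omega> \<partial>M) = c"
    by (simp add: Bochner_Integration.integral_diff[OF integrable_H intq] integral_H c_def)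
  have "(\<integral>\<omega>. (g \<omega>)\<^sup>2 \<partial>M) = (\<integral>\<omega>. (H \<omega> - q \<omega>)\<^sup>2 \<partial>M) - 2 * c * (\<integral>\<omega>. H \<omega> - q \<omega> \<partial>M) + c\<^sup>2"
    unfolding g2
    by (subst Bochner_Integration.integral_add[OF Bochner_Integration.integrable_diff[OF intHq2 integrable_mult_right[OF intHq]]], simp,
        subst Bochner_Integration.integral_diff[OF intHq2 integrable_mult_right[OF intHq]], simp add: prob_space)
  then have fisher: "(\<integral>\<omega>. (g \<omega>)\<^sup>2 \<partial>M) = (\<integral>\<omega>. (H \<omega> - q \<omega>)\<^sup>2 \<partial>M) - (\<integral>\<omega>. q \<omega> \<partial>M)\<^sup>2"
    unfolding Hq by (simp add: c_def power2_eq_square)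
  have gD: "(\<lambda>\<omega>. g \<omega> * D \<omega>) = (\<lambda>\<omega>. D \<omega> * H \<omega> - q \<omega> * D \<omega> - c * D \<omega>)"
    by (rule ext) (simp add: g_def algebra_simps)
  have intgD: "integrable M (\<lambda>\<omega>. g \<omega> * D \<omega>)"
    unfolding gD by (intro Bochner_Integration.integrable_diff intHD intqD integrable_mult_right integrable_D)
  have "(\<integral>\<omega>. g \<omega> * D \<omega> \<partial>M) = (\<integral>\<omega>. D \<omega> * H \<omega> \<partial>M) - (\<integral>\<omega>. q \<omega> * D \<omega> \<partial>M) - c * (\<integral>\<omega>. D \<omega> \<partial>M)"
    unfolding gD
    by (subst Bochner_Integration.integral_diff[OF Bochner_Integration.integrable_diff[OF intHD intqD] integrable_mult_right[OF integrable_D]],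
        subst Bochner_Integration.integral_diff[OF intHD intqD], simp)
  then have "(\<integral>\<omega>. D \<omega> * H \<omega> \<partial>M) - (\<integral>\<omega>. q \<omega> * D \<omega> \<partial>M) = (\<integral>\<omega>. g \<omega> * D \<omega> \<partial>M)"
    by (simp add: integral_D)
  also have "\<dots> \<le> sqrt (\<integral>\<omega>. (g \<omega>)\<^sup>2 \<partial>M) * sqrt (\<integral>\<omega>. (D \<omega>)\<^sup>2 \<partial>M)"
    by (rule integral_mult_le_sqrt[OF _ _ intg2 integrable_D2 intgD]) measurable
  finally have cs: "(\<integral>\<omega>. D \<omega> * H \<omega> \<partial>M) - (\<integral>\<omega>. q \<omega> * D \<omega> \<partial>M) \<le> sqrt (\<integral>\<omega>. (g \<omega>)\<^sup>2 \<partial>M) * sqrt (\<integral>\<omega>. (D \<omega>)\<^sup>2 \<partial>M)" .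
  have "(\<rho> - 1 / 2) / 2 * d = \<rho> / 2 * d - d / 4" for d :: real by (simp add: field_simps)
  then show ?thesis
    using pot cs interaction_energy_diff unfolding fisher by (simp only:)
qed

section \<open>The inequality for one admissible pair of cuts\<close>

lemma log_energy_smooth:
  assumes mu: "circle_prob \<mu>" and dens: "is_smooth_density \<mu> m"
  shows "log_energy \<mu> \<noteq> \<infinity>"
proof -
  have "circle_C 1 m" using dens by (auto simp: is_smooth_density_def circle_smooth_def)
  then have m: "circle_differentiable m" by simp
  obtain C where "\<And>z. z \<in> unit_circle \<Longrightarrow> \<bar>m z\<bar> \<le> C" using circle_differentiable_bounded[OF m] by blast
  then have "\<And>z. z \<in> unit_circle \<Longrightarrow> m z \<le> C" using abs_le_D1 by blast
  with log_energy_bounded_density[OF circle_differentiable_measurable[OF m] _ _ _ mu] dens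
  show ?thesis by (auto simp: is_smooth_density_def)
qed

text \<open>The distance is returned as a real number with a bound independent of the cuts. This
  keeps the supremum finite, so that it can be approximated within the reals.\<close>

lemma free_HWI_arc:
  fixes Q :: "complex \<Rightarrow> real"
  assumes d: "circle_differentiable Q" "circle_differentiable (circle_deriv Q)"
    and conv: "\<And>z. z \<in> unit_circle \<Longrightarrow> \<rho> - 1 / 2 \<le> circle_deriv (circle_deriv Q) z"
    and mu: "circle_prob \<mu>" and nu: "circle_prob \<nu>" and dens: "is_smooth_density \<mu> (smooth_density \<mu>)"
    and nu_energy: "log_energy \<nu> \<noteq> \<infinity>"
    and uv: "u \<in> {0..2 * pi}" "v \<in> {0..2 * pi}"
    and means: "(\<integral>x. x \<partial>lift_from \<mu> u) = (\<integral>x. x \<partial>lift_from \<nu> v)"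
  shows "\<exists>w\<ge>0. w \<le> 4 * pi \<and> wasserstein 2 (lift_from \<mu> u) (lift_from \<nu> v) = ennreal w \<and>
    energy Q \<mu> - energy Q \<nu> \<le> ereal (sqrt (fisher_info Q \<mu>) * w - \<rho> / 2 * w\<^sup>2)"
proof -
  let ?m = "smooth_density \<mu>"
  interpret mu: prob_space \<mu> using mu by (simp add: circle_prob_def)
  interpret nu: prob_space \<nu> using nu by (simp add: circle_prob_def)
  have smooth: "circle_C k ?m" for k using dens by (simp add: is_smooth_density_def circle_smooth_def)
  have m0: "\<And>z. z \<in> unit_circle \<Longrightarrow> 0 \<le> ?m z" and mu_eq: "\<mu> = density circle_haar (\<lambda>z. ennreal (?m z))"
    using dens by (auto simp: is_smooth_density_def)
  have m_diff: "circle_differentiable ?m" using smooth[of 1] by simp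
  have m_meas [measurable]: "?m \<in> borel_measurable circle_borel" by (rule circle_differentiable_measurable[OF m_diff])
  obtain L where L: "0 \<le> L" "\<And>s t. \<bar>?m (cis s) - ?m (cis t)\<bar> \<le> L * \<bar>s - t\<bar>"
    using circle_C1_Lipschitz[OF smooth] by blast
  have mu_energy: "log_energy \<mu> \<noteq> \<infinity>" by (rule log_energy_smooth[OF mu dens])
  have lift_meas: "arc_lift a \<in> borel_measurable \<mu>" "arc_lift a \<in> borel_measurable \<nu>" for a
    unfolding measurable_circle_prob[OF mu] measurable_circle_prob[OF nu] by measurable
  have rd: "real_distribution (lift_from \<mu> u)" "real_distribution (lift_from \<nu> v)"
    unfolding lift_from_eq_distr[OF mu] lift_from_eq_distr[OF nu] real_distribution_def real_distribution_axioms_def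
    using mu.prob_space_distr[OF lift_meas(1)] nu.prob_space_distr[OF lift_meas(2)] by simp_all
  obtain \<Omega> :: "real measure" and X Y where \<Omega>: "prob_space \<Omega>" and [measurable]: "X \<in> borel_measurable \<Omega>" "Y \<in> borel_measurable \<Omega>"
    and dX: "distr \<Omega> borel X = lift_from \<mu> u" and dY: "distr \<Omega> borel Y = lift_from \<nu> v"
    and comon: "comonotone_on (space \<Omega>) X Y"
    using ex_comonotone_coupling[OF rd] by blast
  interpret O: prob_space \<Omega> by fact
  \<comment> \<open>\<open>cis\<close> undoes \<open>arc_lift\<close>, so wrapping a variable with
    the law of a lift back onto the circle recovers the measure, whichever cut was used.\<close>
  have push: "distr \<Omega> circle_borel (\<lambda>\<omega>. cis (Z \<omega>)) = \<sigma>"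
    if [measurable]: "Z \<in> borel_measurable \<Omega>" and Z: "distr \<Omega> borel Z = lift_from \<sigma> a" and \<sigma>: "circle_prob \<sigma>" for Z \<sigma> a
  proof -
    have [measurable]: "arc_lift a \<in> borel_measurable \<sigma>" unfolding measurable_circle_prob[OF \<sigma>] by measurable
    have "distr \<Omega> circle_borel (\<lambda>\<omega>. cis (Z \<omega>)) = distr (distr \<Omega> borel Z) circle_borel cis"
      by (subst distr_distr) (auto simp: comp_def)
    also have "\<dots> = distr \<sigma> circle_borel (\<lambda>z. cis (arc_lift a z))"
      unfolding Z lift_from_eq_distr[OF \<sigma>] by (subst distr_distr) (auto simp: comp_def)
    also have "\<dots> = distr \<sigma> \<sigma> (\<lambda>z. z)"
      using \<sigma> by (intro distr_cong) (auto simp: circle_prob_def space_circle_prob[OF \<sigma>] cis_arc_lift)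
    finally show ?thesis by simp
  qed
  have arc: "AE \<omega> in \<Omega>. a \<le> Z \<omega> \<and> Z \<omega> < a + 2 * pi"
    if [measurable]: "Z \<in> borel_measurable \<Omega>" and Z: "distr \<Omega> borel Z = lift_from \<sigma> a" and \<sigma>: "circle_prob \<sigma>" for Z \<sigma> a
  proof -
    have [measurable]: "arc_lift a \<in> borel_measurable \<sigma>" unfolding measurable_circle_prob[OF \<sigma>] by measurable
    have "AE x in distr \<Omega> borel Z. a \<le> x \<and> x < a + 2 * pi"
      unfolding Z lift_from_eq_distr[OF \<sigma>] by (subst AE_distr_iff) (auto simp: arc_lift_bounds)
    then show ?thesis by (subst (asm) AE_distr_iff) auto
  qed
  note pX = push[OF _ dX mu, simplified] and pY = push[OF _ dY nu, simplified]
  interpret circle_coupling \<Omega> X Y u v ?m L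
  proof
    show "AE \<omega> in \<Omega>. u \<le> X \<omega> \<and> X \<omega> < u + 2 * pi" by (rule arc[OF _ dX mu]) simp
    show "AE \<omega> in \<Omega>. v \<le> Y \<omega> \<and> Y \<omega> < v + 2 * pi" by (rule arc[OF _ dY nu]) simp
    show "(\<integral>\<omega>. X \<omega> \<partial>\<Omega>) = (\<integral>\<omega>. Y \<omega> \<partial>\<Omega>)"
      using means unfolding dX[symmetric] dY[symmetric] by (simp add: integral_distr)
  qed (use comon m0 L pX pY mu_eq mu_energy nu_energy in simp_all)
  define w where "w = sqrt (\<integral>\<omega>. (D \<omega>)\<^sup>2 \<partial>\<Omega>)"
  have w2: "w\<^sup>2 = (\<integral>\<omega>. (D \<omega>)\<^sup>2 \<partial>\<Omega>)" by (simp add: w_def)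
  \<comment> \<open>Arcs that start in [0, 2 pi] end by 4 pi. This is the range required by
    \<open>wasserstein_2_comonotone\<close>, and it also bounds \<open>D\<close>.\<close>
  have bX: "AE \<omega> in \<Omega>. 0 \<le> X \<omega> \<and> X \<omega> \<le> 4 * pi"
    using X_arc uv(1) by (auto elim!: AE_mp)
  have bY: "AE \<omega> in \<Omega>. 0 \<le> Y \<omega> \<and> Y \<omega> \<le> 4 * pi"
    using Y_arc uv(2) by (auto elim!: AE_mp)
  have "wasserstein 2 (lift_from \<mu> u) (lift_from \<nu> v) = ennreal w"
    unfolding w_def D_def dX[symmetric] dY[symmetric]
    by (rule wasserstein_2_comonotone[OF \<Omega> X_meas Y_meas comon bX bY])
  moreover have "w \<le> 4 * pi"
  proof -
    have "(\<integral>\<omega>. (D \<omega>)\<^sup>2 \<partial>\<Omega>) \<le> (4 * pi)\<^sup>2"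
    proof (rule O.integral_le_const[OF integrable_D2])
      show "AE \<omega> in \<Omega>. (D \<omega>)\<^sup>2 \<le> (4 * pi)\<^sup>2"
        using bX bY
      proof eventually_elim
        case (elim \<omega>)
        then have "\<bar>D \<omega>\<bar> \<le> 4 * pi" unfolding D_def by linarith
        from power_mono[OF this abs_ge_zero, where n = 2] show ?case by simp
      qed
    qed
    then show ?thesis unfolding w2[symmetric] by (rule power2_le_imp_le) simp
  qed
  moreover have "energy Q \<mu> - energy Q \<nu> \<le> ereal (sqrt (fisher_info Q \<mu>) * w - \<rho> / 2 * w\<^sup>2)"
  proof -
    note circle_differentiable_measurable[OF d(1), measurable] circle_differentiable_measurable[OF d(2), measurable]
      hilbert_reg_measurable[OF m_meas, measurable]
    have EX: "energy Q \<mu> = ereal ((\<integral>\<omega>. Q (cis (X \<omega>)) \<partial>\<Omega>) + (\<integral>p. fX p \<partial>(\<Omega> \<Otimes>\<^sub>M \<Omega>)))"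
    proof -
      have "(\<integral>z. Q z \<partial>\<mu>) = (\<integral>\<omega>. Q (cis (X \<omega>)) \<partial>\<Omega>)"
        unfolding pX[symmetric] by (subst integral_distr) auto
      then show ?thesis using X_log(3) by (simp add: energy_def pX)
    qed
    have EY: "energy Q \<nu> = ereal ((\<integral>\<omega>. Q (cis (Y \<omega>)) \<partial>\<Omega>) + (\<integral>p. fY p \<partial>(\<Omega> \<Otimes>\<^sub>M \<Omega>)))"
    proof -
      have "(\<integral>z. Q z \<partial>\<nu>) = (\<integral>\<omega>. Q (cis (Y \<omega>)) \<partial>\<Omega>)"
        unfolding pY[symmetric] by (subst integral_distr) auto
      then show ?thesis using Y_log(3) by (simp add: energy_def pY)
    qed
    have "(\<integral>z. (circle_hilbert \<mu> z - circle_deriv Q z)\<^sup>2 \<partial>\<mu>) = (\<integral>z. (hilbert_reg ?m z - circle_deriv Q z)\<^sup>2 \<partial>\<mu>)"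
      using circle_hilbert_eq_hilbert_reg[OF m_meas L(2,1) _ refl]
      by (intro Bochner_Integration.integral_cong) (auto simp: space_circle_prob[OF mu])
    also have "\<dots> = (\<integral>\<omega>. (H \<omega> - circle_deriv Q (cis (X \<omega>)))\<^sup>2 \<partial>\<Omega>)"
    proof -
      have "(\<integral>z. f z \<partial>\<mu>) = (\<integral>\<omega>. f (cis (X \<omega>)) \<partial>\<Omega>)" if [measurable]: "f \<in> borel_measurable circle_borel" for f :: "complex \<Rightarrow> real"
        using integral_distr[of "\<lambda>\<omega>. cis (X \<omega>)" \<Omega> circle_borel f] by (simp add: pX)
      then show ?thesis by (simp add: H_def)
    qed
    finally have "fisher_info Q \<mu> = (\<integral>\<omega>. (H \<omega> - circle_deriv Q (cis (X \<omega>)))\<^sup>2 \<partial>\<Omega>) - (\<integral>\<omega>. circle_deriv Q (cis (X \<omega>)) \<partial>\<Omega>)\<^sup>2"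
      using integral_distr[of "\<lambda>\<omega>. cis (X \<omega>)" \<Omega> circle_borel "circle_deriv Q"] by (simp add: fisher_info_def pX)
    then show ?thesis
      unfolding EX EY using free_HWI_coupling[OF d conv] by (simp add: w2 w_def[symmetric])
  qed
  ultimately show ?thesis by (intro exI[of _ w]) (auto simp: w_def)
qed

section \<open>Passage to the supremum over pairs of cuts\<close>

theorem theorem8:
  fixes Q :: "complex \<Rightarrow> real" and \<rho> :: real and \<mu> \<mu>Q :: "complex measure"
  assumes "circle_C 3 Q"
    and "\<forall>z\<in>unit_circle. circle_deriv (circle_deriv Q) z \<ge> \<rho> - 1 / 2"
    and "is_energy_minimizer Q \<mu>Q"
    and "circle_prob \<mu>" and "smooth_measure \<mu>"
  shows "energy Q \<mu> - energy Q \<mu>Q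
    \<le> ereal (sqrt (fisher_info Q \<mu>)) * enn2ereal (circle_wasserstein 2 \<mu> \<mu>Q)
      - ereal (\<rho> / 2) * (enn2ereal (circle_wasserstein 2 \<mu> \<mu>Q))\<^sup>2"
proof -
  have d: "circle_differentiable Q" "circle_differentiable (circle_deriv Q)"
    using assms(1) by (simp_all add: numeral_3_eq_3)
  have nu: "circle_prob \<mu>Q" using assms(3) by (simp add: is_energy_minimizer_def)
  have dens: "is_smooth_density \<mu> (smooth_density \<mu>)"
    using assms(5) unfolding smooth_measure_def smooth_density_def by (rule someI_ex)
  show ?thesis
  proof (cases "log_energy \<mu>Q = \<infinity>")
    case True
    \<comment> \<open>A smooth density is bounded, so its energy is not infinite and the left-hand
      side becomes minus infinity.\<close>
    have "energy Q \<mu> \<noteq> \<infinity>" using log_energy_smooth[OF assms(4) dens] by (simp add: energy_def)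
    then have "energy Q \<mu> - energy Q \<mu>Q = - \<infinity>" using True by (cases "energy Q \<mu>") (simp_all add: energy_def[of Q \<mu>Q])
    then show ?thesis by simp
  next
    case False
    define S where "S = {(u, v). u \<in> {0..2 * pi} \<and> v \<in> {0..2 * pi} \<and>
                 (\<integral>x. x \<partial>lift_from \<mu> u) = (\<integral>x. x \<partial>lift_from \<mu>Q v)}"
    define W where "W = (\<lambda>(u, v). wasserstein 2 (lift_from \<mu> u) (lift_from \<mu>Q v))"
    define g where "g w = ereal (sqrt (fisher_info Q \<mu>) * w - \<rho> / 2 * w\<^sup>2)" for w
    have "S \<noteq> {}"
    proof -
      have "circle_C 1 (smooth_density \<mu>)" using dens by (auto simp: is_smooth_density_def circle_smooth_def)
      then have "smooth_density \<mu> \<in> borel_measurable circle_borel" by (intro circle_differentiable_measurable) simp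
      then have "emeasure \<mu> {z} = 0" if "z \<in> unit_circle" for z
        using density_circle_haar_atomless[OF _ _ that, of "smooth_density \<mu>"] dens
        by (simp add: is_smooth_density_def)
      from ex_equal_means[OF assms(4) nu this] obtain u v where "(u, v) \<in> S" by (auto simp: S_def)
      then show ?thesis by auto
    qed
    have arc: "\<exists>w\<ge>0. w \<le> 4 * pi \<and> W p = ennreal w \<and> energy Q \<mu> - energy Q \<mu>Q \<le> g w" if "p \<in> S" for p
      using that free_HWI_arc[OF d _ assms(4) nu dens False, of \<rho>] assms(2)
      by (auto simp: S_def W_def g_def)
    have W: "circle_wasserstein 2 \<mu> \<mu>Q = (SUP p\<in>S. W p)"
      unfolding circle_wasserstein_def Let_def S_def[symmetric] W_def[symmetric] using \<open>S \<noteq> {}\<close> by simp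
    have "(SUP p\<in>S. W p) \<le> ennreal (4 * pi)"
    proof (rule SUP_least)
      fix p assume "p \<in> S"
      from arc[OF this] obtain w where "w \<le> 4 * pi" "W p = ennreal w" by blast
      then show "W p \<le> ennreal (4 * pi)" by (simp add: ennreal_leI)
    qed
    then obtain w where w: "(SUP p\<in>S. W p) = ennreal w" "0 \<le> w"
      by (cases "SUP p\<in>S. W p" rule: ennreal_cases) (auto simp: top_unique)
    \<comment> \<open>For positive \<rho> the function \<open>g\<close> eventually decreases, so the
      inequality at smaller distances does not carry over to the supremum by monotonicity. Instead
      \<open>w\<close> is approached within the closed set where the inequality holds.\<close>
    have closed: "closed {x. energy Q \<mu> - energy Q \<mu>Q \<le> g x}"
      unfolding g_def by (intro closed_Collect_le continuous_intros)
    have "w \<in> closure {x. energy Q \<mu> - energy Q \<mu>Q \<le> g x}"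
      unfolding closure_approachable
    proof (intro allI impI)
      fix e :: real assume e: "0 < e"
      \<comment> \<open>For w < e the number w - e is negative and \<open>ennreal\<close> sends it
        to 0, so the strict inequality could fail when all distances are 0. In that case any pair of
        cuts will do, since distances are nonnegative.\<close>
      have "\<exists>p\<in>S. ennreal (w - e) < W p \<or> w < e"
      proof (cases "w < e")
        case True
        then show ?thesis using \<open>S \<noteq> {}\<close> by auto
      next
        case False
        then have "ennreal (w - e) < (SUP p\<in>S. W p)" unfolding w using e by (subst ennreal_less_iff) auto
        then show ?thesis by (auto simp: less_SUP_iff)
      qed
      then obtain p where p: "p \<in> S" "ennreal (w - e) < W p \<or> w < e" by blast
      obtain x where x: "0 \<le> x" "W p = ennreal x" "energy Q \<mu> - energy Q \<mu>Q \<le> g x" using arc[OF p(1)] by blast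
      have "ennreal x \<le> ennreal w" using SUP_upper[OF p(1), of W] by (simp add: x w)
      then have "x \<le> w" using w(2) by (simp add: ennreal_le_iff)
      moreover have "w - e < x"
      proof (cases "w < e")
        case True
        then show ?thesis using x(1) by linarith
      next
        case False
        then show ?thesis using p(2) x(1,2) by (simp add: ennreal_less_iff)
      qed
      ultimately show "\<exists>y\<in>{x. energy Q \<mu> - energy Q \<mu>Q \<le> g x}. dist y w < e"
        using x(3) by (intro bexI[of _ x]) (auto simp: dist_real_def)
    qed
    then have "energy Q \<mu> - energy Q \<mu>Q \<le> g w" using closed by (simp add: closure_closed)
    then show ?thesis using w(2) by (simp add: W w(1) g_def)
  qed
qed

end
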